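(* Let $F\in\mathcal{A}(\mathbb{C}_p)\setminus\mathbb{C}_p[X]$ be such that, for every $\beta\in\mathbb{C}_p$, only finitely many zeros of $F-\beta$ are multiple. Then $F$ is left-prime.
   Context: $p$ is a prime number and $\mathbb{C}_p$ is the completion of an algebraic closure of the field $\mathbb{Q}_p$ of $p$-adic numbers, with the usual $p$-adic absolute value. $\mathcal{A}(\mathbb{C}_p)$ is the algebra of entire functions on $\mathbb{C}_p$ (power series over $\mathbb{C}_p$ converging on all of $\mathbb{C}_p$), and $\mathcal{M}(\mathbb{C}_p)$, the field of meromorphic functions in $\mathbb{C}_p$, is its field of fractions. A meromorphic function is transcendental if it is not a rational function. A linear rational function is one of the form $(ax+b)/(cx+d)$ with $ad-bc\neq0$. A function $F\in\mathcal{M}(\mathbb{C}_p)$ is left-prime if, for every factorization $F=f\circ g$ with $f,g\in\mathcal{M}(\mathbb{C}_p)$, $f$ is a linear rational function whenever $g$ is transcendental. *)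

theory Defs
  imports Complex_Main "HOL-Analysis.Elementary_Metric_Spaces"
    "HOL-Computational_Algebra.Polynomial_FPS"
    "HOL-Computational_Algebra.Fraction_Field"
begin

text \<open>
  A field with an absolute value and its metric topology.  Positivity, definiteness and the
  triangle inequality of \<open>absval\<close> come from the metric axioms through \<open>dist_absval\<close>.
\<close>

class valued_field_char_0 = field_char_0 + metric_space +
  fixes absval :: "'a \<Rightarrow> real"
  assumes dist_absval: "dist x y = absval (x - y)"
    and absval_mult: "absval (x * y) = absval x * absval y"

text \<open>
  \<open>\<complex>\<^sub>p\<close> is only determined up to isometric isomorphism, so it is described by a predicate on the
  type \<open>'a\<close>: the absolute value restricts to the \<open>p\<close>-adic one on the rationals, \<open>'a\<close> is complete
  (so that the closure of the rationals is a copy of the completion \<open>\<rat>\<^sub>p\<close>), the elements of \<open>'a\<close>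
  algebraic over \<open>\<rat>\<^sub>p\<close> form an algebraically closed field, hence an algebraic closure of \<open>\<rat>\<^sub>p\<close>, and
  they are dense, so that \<open>'a\<close> is the completion of this algebraic closure.
\<close>

definition Qp :: "'a :: valued_field_char_0 set" where
  "Qp = closure \<rat>"

definition Qp_bar :: "'a :: valued_field_char_0 set" where
  "Qp_bar = {x. \<exists>q. q \<noteq> 0 \<and> (\<forall>i. coeff q i \<in> Qp) \<and> poly q x = 0}"

definition is_Cp :: "nat \<Rightarrow> 'a :: valued_field_char_0 itself \<Rightarrow> bool" where
  "is_Cp p _ \<longleftrightarrow>
     prime p \<and>
     (\<forall>n::int. n \<noteq> 0 \<longrightarrow> absval (of_int n :: 'a) = 1 / real p ^ multiplicity (int p) n) \<and>
     complete (UNIV :: 'a set) \<and>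
     (\<forall>q :: 'a poly. degree q > 0 \<and> (\<forall>i. coeff q i \<in> Qp_bar) \<longrightarrow> (\<exists>x\<in>Qp_bar. poly q x = 0)) \<and>
     closure (Qp_bar :: 'a set) = UNIV"

definition entire_functions :: "'a :: valued_field_char_0 fps set" where
  "entire_functions = {u. \<forall>x. summable (\<lambda>n. fps_nth u n * x ^ n)}"

definition entire_eval :: "'a :: valued_field_char_0 fps \<Rightarrow> 'a \<Rightarrow> 'a" where
  "entire_eval u x = (\<Sum>n. fps_nth u n * x ^ n)"

text \<open>
  The cofactor must be entire: as a formal power series, \<open>X - a\<close> is invertible for \<open>a \<noteq> 0\<close>.
\<close>

definition multiple_zero :: "'a :: valued_field_char_0 fps \<Rightarrow> 'a \<Rightarrow> bool" where
  "multiple_zero u a \<longleftrightarrow> (\<exists>h\<in>entire_functions. u = (fps_X - fps_const a) ^ 2 * h)"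

text \<open>
  The field of fractions of the entire functions, as a subfield of the field of fractions of
  all formal power series.
\<close>

definition meromorphic_functions :: "'a :: valued_field_char_0 fps fract set" where
  "meromorphic_functions = {Fract u v | u v. u \<in> entire_functions \<and> v \<in> entire_functions \<and> v \<noteq> 0}"

text \<open>
  \<open>has_value h x y\<close>: the function \<open>h\<close> has no pole at \<open>x\<close> and takes the value \<open>y\<close> there.  As common
  zeros of numerator and denominator can be cancelled, \<open>x\<close> is a pole of a meromorphic
  function iff it has no value at \<open>x\<close>.
\<close>

definition has_value :: "'a :: valued_field_char_0 fps fract \<Rightarrow> 'a \<Rightarrow> 'a \<Rightarrow> bool" where
  "has_value h x y \<longleftrightarrow>
     (\<exists>u\<in>entire_functions. \<exists>v\<in>entire_functions.
        h = Fract u v \<and> entire_eval v x \<noteq> 0 \<and> y = entire_eval u x / entire_eval v x)"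

text \<open>
  \<open>F = f \<circ> g\<close>: at every \<open>x\<close> that is not a pole of \<open>g\<close>, \<open>F x\<close> and \<open>f (g x)\<close> agree as elements of the
  projective line, that is, both have the same value or both have a pole.  At poles of \<open>g\<close> the
  right-hand side is undefined unless \<open>f\<close> is rational, and then equality there follows by
  continuity.
\<close>

definition is_composition ::
    "'a :: valued_field_char_0 fps fract \<Rightarrow> 'a fps fract \<Rightarrow> 'a fps fract \<Rightarrow> bool" where
  "is_composition F f g \<longleftrightarrow>
     (\<forall>x y. has_value g x y \<longrightarrow> (\<forall>z. has_value F x z \<longleftrightarrow> has_value f y z))"

definition rational_functions :: "'a :: valued_field_char_0 fps fract set" where
  "rational_functions = {Fract (fps_of_poly P) (fps_of_poly Q) | P Q. Q \<noteq> 0}"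

definition linear_rational :: "'a :: valued_field_char_0 fps fract \<Rightarrow> bool" where
  "linear_rational f \<longleftrightarrow>
     (\<exists>a b c d. a * d - b * c \<noteq> 0 \<and> f = Fract (fps_of_poly [:b, a:]) (fps_of_poly [:d, c:]))"

definition left_prime :: "'a :: valued_field_char_0 fps fract \<Rightarrow> bool" where
  "left_prime F \<longleftrightarrow>
     F \<in> meromorphic_functions \<and>
     (\<forall>f\<in>meromorphic_functions. \<forall>g\<in>meromorphic_functions.
        is_composition F f g \<longrightarrow> g \<notin> rational_functions \<longrightarrow> linear_rational f)"

end

theory Submission
  imports Defs
begin

text \<open>
  The proof rests on the existence of zeros: over \<open>\<complex>\<^sub>p\<close> an entire function has as many zeros in each
  disc as the size of its coefficients predicts (\<open>zero_if_dominant_index_pos\<close>), and a nonconstant one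
  has at least one zero (\<open>constant_if_no_zero\<close>).  It follows that an entire function that is not a
  polynomial takes every value infinitely often, that a meromorphic function without poles is
  entire, and that bounded entire functions are constant.

  Suppose first that \<open>F = f \<circ> g\<close> with \<open>f\<close> and \<open>g\<close> entire and \<open>g\<close> not a polynomial
  (\<open>left_factor_linear\<close>).  If \<open>f'\<close> had a zero \<open>c\<close>, then \<open>F - f c\<close> would have a multiple zero at each of
  the infinitely many points where \<open>g\<close> takes the value \<open>c\<close>.  So \<open>f'\<close> has no zero and is constant, and
  in characteristic \<open>0\<close> this means that \<open>f\<close> is linear.

  The meromorphic case reduces to this one.  If \<open>g\<close> has no pole, it is entire and takes every
  value; as \<open>F\<close> has no pole, neither has \<open>f\<close>, so \<open>f\<close> is entire.

  If \<open>g\<close> has a pole, the image under \<open>g\<close> of some disc contains all sufficiently large values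
  (\<open>large_values_near_pole\<close>).  As \<open>F\<close> is bounded on that disc, \<open>f\<close> is bounded near infinity.  Then
  \<open>f\<close> has a pole \<open>b\<close>, since otherwise \<open>f\<close> and \<open>F\<close> would be constant.  The function \<open>g\<close>
  omits \<open>b\<close>, so that \<open>g = b + 1 / H\<close> with \<open>H\<close> entire, and \<open>H\<close> takes every value; hence \<open>b\<close> is the
  only pole of \<open>f\<close>.  A function that is bounded near infinity and has \<open>b\<close> as its only pole is a
  polynomial \<open>q\<close> in \<open>1 / (X - b)\<close>.  Now \<open>F = q \<circ> H\<close> is a composition of entire functions, so
  \<open>q = \<alpha> + \<beta> X\<close> and \<open>f = \<alpha> + \<beta> / (X - b)\<close>.

  The existence of zeros is obtained from the largest index \<open>d\<close> at which \<open>\<bar>u\<^sub>n\<bar> r\<^sup>n\<close> is maximal.  It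
  is the number of zeros in the disc \<open>\<bar>x\<bar> \<le> r\<close>, counted with multiplicity.  It is additive under
  products and stable under small perturbations of the series, so a series with \<open>d > 0\<close> that is
  approximated by products of linear factors has a zero as the limit of zeros of these products.
\<close>

section \<open>Absolute values\<close>

lemma absval_zero [simp]: "absval (0 :: 'a :: valued_field_char_0) = 0"
  using dist_absval[of "0::'a" 0] by simp

lemma absval_nonneg [simp]: "absval (x :: 'a :: valued_field_char_0) \<ge> 0"
  using dist_absval[of x 0] by (metis diff_zero zero_le_dist)

lemma absval_eq_0_iff [simp]: "absval (x :: 'a :: valued_field_char_0) = 0 \<longleftrightarrow> x = 0"
  using dist_absval[of x 0] by (metis diff_zero dist_eq_0_iff)

lemma absval_pos_iff [simp]: "absval (x :: 'a :: valued_field_char_0) > 0 \<longleftrightarrow> x \<noteq> 0"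
  by (metis absval_eq_0_iff absval_nonneg less_le)

lemma absval_one [simp]: "absval (1 :: 'a :: valued_field_char_0) = 1"
  using absval_mult[of "1::'a" 1] by simp

lemma absval_minus [simp]: "absval (- x :: 'a :: valued_field_char_0) = absval x"
  using dist_absval[of x 0] dist_absval[of 0 x] by (simp add: dist_commute)

lemma absval_minus_commute: "absval (x - y :: 'a :: valued_field_char_0) = absval (y - x)"
  by (metis absval_minus minus_diff_eq)

lemma absval_power: "absval (x ^ n :: 'a :: valued_field_char_0) = absval x ^ n"
  by (induction n) (simp_all add: absval_mult)

lemma absval_inverse: "absval (inverse x :: 'a :: valued_field_char_0) = inverse (absval x)"
proof (cases "x = 0")
  case False
  then have "absval x * absval (inverse x) = 1"
    by (simp flip: absval_mult)
  then show ?thesis by (simp add: inverse_unique)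
qed simp

lemma absval_triangle: "absval (x + y :: 'a :: valued_field_char_0) \<le> absval x + absval y"
  using dist_triangle[of x "-y" 0] dist_absval[of x "-y"] dist_absval[of x 0] dist_absval[of "-y" 0]
  by (simp add: dist_commute)

lemma absval_sum_le: "absval (sum f A :: 'a :: valued_field_char_0) \<le> (\<Sum>i\<in>A. absval (f i))"
proof (induction A rule: infinite_finite_induct)
  case (insert i A)
  then show ?case using absval_triangle[of "f i" "sum f A"] by simp
qed simp_all

text \<open>
  The binomial theorem gives \<open>\<bar>x + y\<bar>\<^sup>n \<le> (n + 1) max(\<bar>x\<bar>, \<bar>y\<bar>)\<^sup>n\<close>; the factor \<open>n + 1\<close> disappears
  in the \<open>n\<close>-th root as \<open>n\<close> grows.
\<close>

lemma ultrametric_if_naturals_bounded: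
  fixes x y :: "'a :: valued_field_char_0"
  assumes "\<And>n. absval (of_nat n :: 'a) \<le> 1"
  shows "absval (x + y) \<le> max (absval x) (absval y)"
proof (rule ccontr)
  define m where "m = max (absval x) (absval y)"
  define s where "s = absval (x + y)"
  assume "\<not> ?thesis"
  then have ms: "m < s" unfolding m_def s_def by linarith
  have m0: "0 \<le> m" by (simp add: m_def le_max_iff_disj)
  have le: "s ^ n \<le> real (Suc n) * m ^ n" for n
  proof -
    have "s ^ n = absval (\<Sum>k\<le>n. of_nat (n choose k) * x ^ k * y ^ (n - k))"
      by (simp add: s_def binomial_ring flip: absval_power)
    also have "\<dots> \<le> (\<Sum>k\<le>n. absval (of_nat (n choose k) * x ^ k * y ^ (n - k)))"
      by (rule absval_sum_le)
    also have "\<dots> \<le> (\<Sum>k\<le>n. m ^ n)"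
    proof (rule sum_mono)
      fix k assume "k \<in> {..n}"
      have "absval (of_nat (n choose k) * x ^ k * y ^ (n - k)) \<le> 1 * m ^ k * m ^ (n - k)"
        unfolding absval_mult absval_power
        by (intro mult_mono power_mono assms) (auto simp: m_def le_max_iff_disj)
      also have "\<dots> = m ^ n" using \<open>k \<in> {..n}\<close> by (simp flip: power_add)
      finally show "absval (of_nat (n choose k) * x ^ k * y ^ (n - k)) \<le> m ^ n" .
    qed
    finally show ?thesis by simp
  qed
  have "m \<noteq> 0"
  proof
    assume "m = 0"
    with le[of 1] ms show False by simp
  qed
  with m0 have m0: "m > 0" by simp
  define q where "q = m / s"
  have q: "0 < q" "q < 1" using ms m0 by (auto simp: q_def)
  have "(\<lambda>n. real n * q ^ n) \<longlonglongrightarrow> 0" and "(\<lambda>n. q ^ n) \<longlonglongrightarrow> 0"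
    using q by (auto intro: powser_times_n_limit_0 LIMSEQ_realpow_zero)
  from tendsto_add[OF this] have "(\<lambda>n. real (Suc n) * q ^ n) \<longlonglongrightarrow> 0"
    by (simp add: algebra_simps)
  moreover have "1 \<le> real (Suc n) * q ^ n" for n
    using le[of n] ms m0 by (simp add: q_def power_divide field_simps)
  ultimately have "1 \<le> (0::real)" by (intro LIMSEQ_le_const) auto
  then show False by simp
qed

section \<open>Dominant indices\<close>

text \<open>
The Weierstrass degree of \<open>u\<close> on the disc \<open>\<bar>x\<bar> \<le> r\<close>, as a relation because the maximum exists only
for nonzero series that converge there.
\<close>

definition dominant_index :: "real \<Rightarrow> 'a :: valued_field_char_0 fps \<Rightarrow> nat \<Rightarrow> bool" where
  "dominant_index r u d \<longleftrightarrow>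
     fps_nth u d \<noteq> 0 \<and>
     (\<forall>n. absval (fps_nth u n) * r ^ n \<le> absval (fps_nth u d) * r ^ d) \<and>
     (\<forall>n>d. absval (fps_nth u n) * r ^ n < absval (fps_nth u d) * r ^ d)"

lemma dominant_indexD:
  assumes "dominant_index r u d"
  shows "fps_nth u d \<noteq> 0" "absval (fps_nth u n) * r ^ n \<le> absval (fps_nth u d) * r ^ d"
    "n > d \<Longrightarrow> absval (fps_nth u n) * r ^ n < absval (fps_nth u d) * r ^ d"
  using assms by (auto simp: dominant_index_def)

lemma dominant_index_unique: "dominant_index r u d \<Longrightarrow> dominant_index r u e \<Longrightarrow> d = e"
  by (metis dominant_indexD(2,3) linorder_neqE_nat not_less)

lemma dominant_index_const: "c \<noteq> 0 \<Longrightarrow> dominant_index r (fps_const c) 0"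
  by (simp add: dominant_index_def)

lemma dominant_index_linear:
  fixes a :: "'a :: valued_field_char_0"
  assumes "r > 0"
  shows "dominant_index r (fps_X - fps_const a) (if absval a \<le> r then 1 else 0)"
  using assms by (auto simp: dominant_index_def fps_X_def)

section \<open>Entire functions over a complete nonarchimedean field\<close>

text \<open>
The parameter serves to fix the type of the field.
\<close>

locale nonarchimedean =
  fixes K :: "'a :: valued_field_char_0 itself"
  assumes ultrametric: "absval (x + y :: 'a) \<le> max (absval x) (absval y)"
    and complete_UNIV: "complete (UNIV :: 'a set)"
    and nontrivial: "\<exists>x::'a. x \<noteq> 0 \<and> absval x < 1"
begin

lemma absval_add_le: "absval (x::'a) \<le> B \<Longrightarrow> absval y \<le> B \<Longrightarrow> absval (x + y) \<le> B"
  using ultrametric[of x y] by linarith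

lemma absval_add_less: "absval (x::'a) < B \<Longrightarrow> absval y < B \<Longrightarrow> absval (x + y) < B"
  using ultrametric[of x y] by linarith

lemma absval_diff_le: "absval (x::'a) \<le> B \<Longrightarrow> absval y \<le> B \<Longrightarrow> absval (x - y) \<le> B"
  using absval_add_le[of x B "-y"] by simp

lemma absval_add_eq:
  assumes "absval (y::'a) < absval x" shows "absval (x + y) = absval x"
proof (rule antisym)
  show "absval (x + y) \<le> absval x" using assms by (intro absval_add_le) auto
  have "absval x \<le> max (absval (x + y)) (absval y)"
    using ultrametric[of "x + y" "-y"] by simp
  then show "absval x \<le> absval (x + y)" using assms by linarith
qed

lemma absval_sum_bound:
  assumes "\<And>i. i \<in> A \<Longrightarrow> absval (f i :: 'a) \<le> B" "0 \<le> B"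
  shows "absval (sum f A) \<le> B"
  using assms by (induction A rule: infinite_finite_induct) (auto intro: absval_add_le)

lemma absval_sum_less:
  assumes "\<And>i. i \<in> A \<Longrightarrow> absval (f i :: 'a) < B" "0 < B"
  shows "absval (sum f A) < B"
  using assms by (induction A rule: infinite_finite_induct) (auto intro: absval_add_less)

lemma absval_of_nat_le: "absval (of_nat n :: 'a) \<le> 1"
  by (induction n) (auto intro: absval_add_le)

lemma ex_absval_small:
  assumes "0 < e" shows "\<exists>x::'a. x \<noteq> 0 \<and> absval x < e"
proof -
  obtain x :: 'a where x: "x \<noteq> 0" "absval x < 1" using nontrivial by blast
  then obtain n where "absval x ^ n < e" using assms real_arch_pow_inv by blast
  with x show ?thesis by (intro exI[of _ "x ^ n"]) (simp add: absval_power)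
qed

lemma ex_absval_large: "\<exists>x::'a. r < absval x"
proof -
  obtain x :: 'a where x: "x \<noteq> 0" "absval x < inverse (\<bar>r\<bar> + 1)"
    using ex_absval_small[of "inverse (\<bar>r\<bar> + 1)"]
    by (metis abs_ge_zero add_nonneg_pos positive_imp_inverse_positive zero_less_one)
  then have "\<bar>r\<bar> + 1 < inverse (absval x)"
    by (metis absval_pos_iff inverse_inverse_eq inverse_less_imp_less positive_imp_inverse_positive)
  then show ?thesis by (intro exI[of _ "inverse x"]) (simp add: absval_inverse)
qed

lemma lim_absval_le:
  assumes "s \<longlonglongrightarrow> (l::'a)" "\<And>n. absval (s n) \<le> B"
  shows "absval l \<le> B"
proof -
  have "(\<lambda>n. dist (s n) 0) \<longlonglongrightarrow> dist l 0" by (intro tendsto_intros assms)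
  then have "(\<lambda>n. absval (s n)) \<longlonglongrightarrow> absval l" by (simp add: dist_absval)
  then show ?thesis using assms(2) by (intro LIMSEQ_le_const2) auto
qed

lemma LIMSEQ_iff_absval: "s \<longlonglongrightarrow> (l::'a) \<longleftrightarrow> (\<lambda>n. absval (s n - l)) \<longlonglongrightarrow> 0"
  by (subst tendsto_dist_iff) (simp add: dist_absval)

lemma tendsto_affine:
  assumes "s \<longlonglongrightarrow> (l::'a)" shows "(\<lambda>n. c + a * s n) \<longlonglongrightarrow> c + a * l"
proof -
  have "(\<lambda>n. absval a * absval (s n - l)) \<longlonglongrightarrow> absval a * 0"
    using assms by (intro tendsto_intros) (simp add: LIMSEQ_iff_absval)
  then show ?thesis by (simp add: LIMSEQ_iff_absval flip: absval_mult right_diff_distrib)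
qed

text \<open>
The strong triangle inequality makes a sequence Cauchy as soon as its increments tend to \<open>0\<close>.
\<close>

lemma convergent_if_increments_small:
  assumes "\<And>n. absval (s (Suc n) - s n :: 'a) \<le> B n" "decseq B" "B \<longlonglongrightarrow> 0"
  shows "\<exists>l. s \<longlonglongrightarrow> l"
proof -
  have step: "absval (s (n + k) - s n) \<le> B n" for n k
  proof (induction k)
    case 0
    show ?case using order_trans[OF absval_nonneg assms(1)] by simp
  next
    case (Suc k)
    have "absval (s (Suc (n + k)) - s (n + k)) \<le> B n"
      using assms(1)[of "n + k"] decseqD[OF assms(2), of n "n + k"] by simp
    from absval_add_le[OF this Suc.IH] show ?case by simp
  qed
  have "Cauchy s"
  proof (rule metric_CauchyI)
    fix e :: real assume "0 < e"
    then have "eventually (\<lambda>n. B n < e) sequentially"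
      using assms(3) by (simp add: order_tendsto_iff)
    then obtain N where N: "B N < e" by (auto simp: eventually_sequentially)
    have "dist (s m) (s n) < e" if "m \<ge> N" "n \<ge> N" for m n
    proof -
      have "absval (s m - s N) \<le> B N" "absval (s n - s N) \<le> B N"
        using step[of N "m - N"] step[of N "n - N"] that by simp_all
      from absval_diff_le[OF this] show ?thesis using N by (simp add: dist_absval)
    qed
    then show "\<exists>M. \<forall>m\<ge>M. \<forall>n\<ge>M. dist (s m) (s n) < e" by blast
  qed
  then show ?thesis using complete_UNIV unfolding complete_def by blast
qed

lemma terms_le_geometric:
  assumes "\<And>n. absval (fps_nth (u :: 'a fps) n) * (2 * r) ^ n \<le> B"
  shows "absval (fps_nth u n) * r ^ n \<le> B * (1/2) ^ n"
proof -
  have "absval (fps_nth u n) * r ^ n = absval (fps_nth u n) * (2 * r) ^ n * (1/2) ^ n"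
    by (simp add: power_mult_distrib power_divide)
  also have "\<dots> \<le> B * (1/2) ^ n" by (intro mult_right_mono assms) auto
  finally show ?thesis .
qed

text \<open>
Boundedness on the radius \<open>2 r\<close> forces geometric decay on the radius \<open>r\<close>, hence convergence of the
series.  This criterion reduces closure properties to estimates of coefficients.
\<close>

lemma entire_iff_bounded:
  "(u :: 'a fps) \<in> entire_functions \<longleftrightarrow> (\<forall>r>0. \<exists>B. \<forall>n. absval (fps_nth u n) * r ^ n \<le> B)"
proof (intro iffI allI impI)
  fix r :: real
  assume u: "u \<in> entire_functions" and r: "0 < r"
  \<comment> \<open>The terms of a convergent series are bounded, and this bounds the coefficients on the smaller radius \<open>r\<close>.\<close>
  obtain x :: 'a where x: "r < absval x" using ex_absval_large by blast
  let ?s = "\<lambda>N. \<Sum>n<N. fps_nth u n * x ^ n"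
  obtain l where "?s \<longlonglongrightarrow> l"
    using u by (auto simp: entire_functions_def summable_def sums_def)
  then have "bounded (range ?s)" by (intro cauchy_imp_bounded LIMSEQ_imp_Cauchy)
  then obtain B where B: "\<And>N. absval (?s N) \<le> B"
    by (auto simp: bounded_any_center[where a = 0] dist_absval)
  show "\<exists>B. \<forall>n. absval (fps_nth u n) * r ^ n \<le> B"
  proof (intro exI[of _ B] allI)
    fix n
    have "absval (fps_nth u n) * r ^ n \<le> absval (fps_nth u n) * absval x ^ n"
      using x r by (intro mult_left_mono power_mono) auto
    also have "\<dots> = absval (?s (Suc n) - ?s n)" by (simp add: absval_mult absval_power)
    also have "\<dots> \<le> B" by (intro absval_diff_le B)
    finally show "absval (fps_nth u n) * r ^ n \<le> B" .
  qed
next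
  assume *: "\<forall>r>0. \<exists>B. \<forall>n. absval (fps_nth u n) * r ^ n \<le> B"
  have "summable (\<lambda>n. fps_nth u n * x ^ n)" for x
  proof -
    define r where "r = absval x + 1"
    have r: "r > 0" by (simp add: r_def add_nonneg_pos)
    obtain B where B: "\<And>n. absval (fps_nth u n) * (2 * r) ^ n \<le> B" using *[rule_format, of "2 * r"] r by auto
    have B0: "B \<ge> 0" using order_trans[OF absval_nonneg, of "fps_nth u 0"] B[of 0] by simp
    have small: "absval (fps_nth u n * x ^ n) \<le> B * (1/2) ^ n" for n
    proof -
      have "absval (fps_nth u n * x ^ n) \<le> absval (fps_nth u n) * r ^ n"
        by (simp add: absval_mult absval_power r_def mult_left_mono power_mono)
      also have "\<dots> \<le> B * (1/2) ^ n" by (rule terms_le_geometric[OF B])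
      finally show ?thesis .
    qed
    have "decseq (\<lambda>n. B * (1/2) ^ n)"
      using B0 by (intro decseq_SucI) (simp add: mult_left_mono)
    moreover have "(\<lambda>n. B * (1/2) ^ n) \<longlonglongrightarrow> 0"
      by (intro tendsto_mult_right_zero LIMSEQ_realpow_zero) auto
    ultimately have "\<exists>l. (\<lambda>N. \<Sum>n<N. fps_nth u n * x ^ n) \<longlonglongrightarrow> l"
      by (intro convergent_if_increments_small) (use small in auto)
    then show ?thesis by (auto simp: summable_def sums_def)
  qed
  then show "u \<in> entire_functions" by (simp add: entire_functions_def)
qed

lemma entire_boundedE:
  assumes "(u :: 'a fps) \<in> entire_functions" "r > 0"
  obtains B where "B \<ge> 0" "\<And>n. absval (fps_nth u n) * r ^ n \<le> B"
proof -
  from assms obtain B where B: "\<And>n. absval (fps_nth u n) * r ^ n \<le> B"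
    by (auto simp: entire_iff_bounded)
  moreover have "B \<ge> 0" using order_trans[OF absval_nonneg, of "fps_nth u 0"] B[of 0] by simp
  ultimately show ?thesis using that by blast
qed

lemma entire_terms_tendsto_0:
  assumes "(u :: 'a fps) \<in> entire_functions" "r > 0"
  shows "(\<lambda>n. absval (fps_nth u n) * r ^ n) \<longlonglongrightarrow> 0"
proof -
  obtain B where B: "B \<ge> 0" "\<And>n. absval (fps_nth u n) * (2 * r) ^ n \<le> B"
    by (rule entire_boundedE[OF assms(1), of "2 * r"]) (use assms in simp, blast)
  have "absval (fps_nth u n) * r ^ n \<le> B * (1/2) ^ n" for n
    by (rule terms_le_geometric[OF B(2)])
  then have le: "\<forall>\<^sub>F n in sequentially. absval (fps_nth u n) * r ^ n \<le> B * (1/2) ^ n"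
    by simp
  have "(\<lambda>n. B * (1/2) ^ n) \<longlonglongrightarrow> 0"
    by (intro tendsto_mult_right_zero LIMSEQ_realpow_zero) auto
  from tendsto_sandwich[OF _ le tendsto_const this] show ?thesis using assms(2) by simp
qed

lemma entire_add [intro]:
  assumes "(u :: 'a fps) \<in> entire_functions" "v \<in> entire_functions"
  shows "u + v \<in> entire_functions"
  unfolding entire_iff_bounded
proof (intro allI impI)
  fix r :: real assume r: "r > 0"
  obtain B where B: "B \<ge> 0" "\<And>n. absval (fps_nth u n) * r ^ n \<le> B" by (rule entire_boundedE[OF assms(1) r]) blast
  obtain C where C: "C \<ge> 0" "\<And>n. absval (fps_nth v n) * r ^ n \<le> C" by (rule entire_boundedE[OF assms(2) r]) blast
  show "\<exists>B. \<forall>n. absval (fps_nth (u + v) n) * r ^ n \<le> B"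
  proof (intro exI[of _ "B + C"] allI)
    fix n
    have "absval (fps_nth (u + v) n) * r ^ n \<le> (absval (fps_nth u n) + absval (fps_nth v n)) * r ^ n"
      using r by (intro mult_right_mono) (auto intro: absval_triangle)
    also have "\<dots> \<le> B + C" using B(2)[of n] C(2)[of n] by (simp add: algebra_simps)
    finally show "absval (fps_nth (u + v) n) * r ^ n \<le> B + C" .
  qed
qed

lemma entire_mult [intro]:
  assumes "(u :: 'a fps) \<in> entire_functions" "v \<in> entire_functions"
  shows "u * v \<in> entire_functions"
  unfolding entire_iff_bounded
proof (intro allI impI)
  fix r :: real assume r: "r > 0"
  obtain B where B: "B \<ge> 0" "\<And>n. absval (fps_nth u n) * r ^ n \<le> B" by (rule entire_boundedE[OF assms(1) r]) blast
  obtain C where C: "C \<ge> 0" "\<And>n. absval (fps_nth v n) * r ^ n \<le> C" by (rule entire_boundedE[OF assms(2) r]) blast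
  show "\<exists>B. \<forall>n. absval (fps_nth (u * v) n) * r ^ n \<le> B"
  proof (intro exI[of _ "B * C"] allI)
    fix n
    have "absval (fps_nth (u * v) n) \<le> B * C / r ^ n"
      unfolding fps_mult_nth
    proof (rule absval_sum_bound)
      fix i assume i: "i \<in> {0..n}"
      have "absval (fps_nth u i * fps_nth v (n - i)) * r ^ n =
            (absval (fps_nth u i) * r ^ i) * (absval (fps_nth v (n - i)) * r ^ (n - i))"
        using i by (simp add: absval_mult flip: power_add)
      also have "\<dots> \<le> B * C" using B C r by (intro mult_mono) auto
      finally show "absval (fps_nth u i * fps_nth v (n - i)) \<le> B * C / r ^ n"
        using r by (simp add: pos_le_divide_eq)
    qed (use B C r in auto)
    then show "absval (fps_nth (u * v) n) * r ^ n \<le> B * C" using r by (simp add: pos_le_divide_eq)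
  qed
qed

lemma entire_of_poly [intro, simp]: "fps_of_poly (q :: 'a poly) \<in> entire_functions"
  unfolding entire_iff_bounded
proof (intro allI impI)
  fix r :: real assume r: "r > 0"
  show "\<exists>B. \<forall>n. absval (fps_nth (fps_of_poly q) n) * r ^ n \<le> B"
  proof (intro exI allI)
    fix n
    show "absval (fps_nth (fps_of_poly q) n) * r ^ n \<le> (\<Sum>i\<le>degree q. absval (coeff q i) * r ^ i)"
    proof (cases "n \<le> degree q")
      case True
      then show ?thesis using r
        by (auto intro!: member_le_sum[where f = "\<lambda>i. absval (coeff q i) * r ^ i"])
    next
      case False
      then show ?thesis using r by (auto simp: coeff_eq_0 intro!: sum_nonneg)
    qed
  qed
qed

lemma entire_const [intro, simp]: "fps_const (c :: 'a) \<in> entire_functions"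
  using entire_of_poly[of "[:c:]"] by (simp only: fps_of_poly_const)

lemma entire_X [intro, simp]: "(fps_X :: 'a fps) \<in> entire_functions"
  using entire_of_poly[of "[:0, 1:]"] by (simp only: fps_of_poly_fps_X)

lemma entire_0 [intro, simp]: "(0 :: 'a fps) \<in> entire_functions"
  using entire_const[of 0] by simp

lemma entire_1 [intro, simp]: "(1 :: 'a fps) \<in> entire_functions"
  using entire_const[of 1] by simp

lemma entire_diff [intro]:
  assumes "(u :: 'a fps) \<in> entire_functions" "v \<in> entire_functions"
  shows "u - v \<in> entire_functions"
proof -
  have "u + fps_const (-1) * v \<in> entire_functions" using assms by (intro entire_add entire_mult) auto
  then show ?thesis by (simp flip: fps_const_neg)
qed

lemma entire_power [intro]: "(u :: 'a fps) \<in> entire_functions \<Longrightarrow> u ^ n \<in> entire_functions"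
  by (induction n) auto

lemma entire_deriv [intro]:
  assumes "(u :: 'a fps) \<in> entire_functions" shows "fps_deriv u \<in> entire_functions"
  unfolding entire_iff_bounded
proof (intro allI impI)
  fix r :: real assume r: "r > 0"
  obtain B where B: "B \<ge> 0" "\<And>n. absval (fps_nth u n) * r ^ n \<le> B" by (rule entire_boundedE[OF assms r]) blast
  show "\<exists>B. \<forall>n. absval (fps_nth (fps_deriv u) n) * r ^ n \<le> B"
  proof (intro exI[of _ "B / r"] allI)
    fix n
    have "absval (of_nat (Suc n) :: 'a) * absval (fps_nth u (Suc n)) \<le> 1 * absval (fps_nth u (Suc n))"
      by (intro mult_right_mono absval_of_nat_le) auto
    then have "absval (fps_nth (fps_deriv u) n) * r ^ n \<le> absval (fps_nth u (Suc n)) * r ^ n"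
      using r by (simp add: absval_mult mult_right_mono del: of_nat_Suc)
    also have "\<dots> \<le> B / r" using B(2)[of "Suc n"] r by (simp add: field_simps)
    finally show "absval (fps_nth (fps_deriv u) n) * r ^ n \<le> B / r" .
  qed
qed

lemma eval_sums:
  "(u :: 'a fps) \<in> entire_functions \<Longrightarrow> (\<lambda>n. fps_nth u n * x ^ n) sums entire_eval u x"
  by (simp add: entire_functions_def entire_eval_def summable_sums)

lemma absval_eval_le:
  assumes "(u :: 'a fps) \<in> entire_functions" "\<And>n. absval (fps_nth u n) * r ^ n \<le> B" "absval x \<le> r"
  shows "absval (entire_eval u x) \<le> B"
proof (rule lim_absval_le)
  show "(\<lambda>N. \<Sum>n<N. fps_nth u n * x ^ n) \<longlonglongrightarrow> entire_eval u x"
    using eval_sums[OF assms(1)] by (simp add: sums_def)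
  fix N
  show "absval (\<Sum>n<N. fps_nth u n * x ^ n) \<le> B"
  proof (rule absval_sum_bound)
    fix n
    have "absval (fps_nth u n * x ^ n) \<le> absval (fps_nth u n) * r ^ n"
      using assms(3) by (simp add: absval_mult absval_power mult_left_mono power_mono)
    also have "\<dots> \<le> B" by (rule assms)
    finally show "absval (fps_nth u n * x ^ n) \<le> B" .
  next
    show "0 \<le> B" using order_trans[OF absval_nonneg, of "fps_nth u 0"] assms(2)[of 0] by simp
  qed
qed

lemma eval_bounded_on_disc:
  assumes "(u :: 'a fps) \<in> entire_functions"
  obtains B where "B \<ge> 0" "\<And>x. absval x \<le> r \<Longrightarrow> absval (entire_eval u x) \<le> B"
proof -
  obtain B where B: "B \<ge> 0" "\<And>n. absval (fps_nth u n) * (\<bar>r\<bar> + 1) ^ n \<le> B"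
    by (rule entire_boundedE[OF assms, of "\<bar>r\<bar> + 1"]) (linarith, blast)
  show ?thesis
    by (rule that[OF B(1)]) (rule absval_eval_le[OF assms B(2)], linarith)
qed

text \<open>
Together with \<open>entire_division\<close> this characterizes the value \<open>u a\<close> as the remainder of \<open>u\<close> modulo
\<open>X - a\<close>.  Evaluation is therefore a ring homomorphism, and no product of series has to be rearranged.
\<close>

lemma eval_unique:
  assumes k: "(k :: 'a fps) \<in> entire_functions"
    and u: "u = fps_const c + (fps_X - fps_const a) * k"
  shows "entire_eval u a = c"
proof -
  \<comment> \<open>The partial sums telescope.\<close>
  have partial: "(\<Sum>n<Suc N. fps_nth u n * a ^ n) = c + (- a) * (fps_nth k N * a ^ N)" for N
  proof (induction N)
    case (Suc N)
    have e: "fps_nth u (Suc N) = fps_nth k N - a * fps_nth k (Suc N)"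
      by (simp add: u left_diff_distrib)
    show ?case by (subst sum.lessThan_Suc, subst Suc.IH, subst e) (simp add: algebra_simps)
  qed (simp add: u left_diff_distrib)
  have "(\<lambda>N. fps_nth k N * a ^ N) \<longlonglongrightarrow> 0"
  proof -
    let ?b = "\<lambda>N. absval (fps_nth k N) * (absval a + 1) ^ N"
    have lim: "?b \<longlonglongrightarrow> 0"
      by (intro entire_terms_tendsto_0 k add_nonneg_pos) auto
    have "absval (fps_nth k N * a ^ N) \<le> ?b N" for N
      by (simp add: absval_mult absval_power mult_left_mono power_mono)
    then have le: "\<forall>\<^sub>F N in sequentially. absval (fps_nth k N * a ^ N) \<le> ?b N"
      by simp
    from tendsto_sandwich[OF _ le tendsto_const lim]
    have "(\<lambda>N. absval (fps_nth k N * a ^ N)) \<longlonglongrightarrow> 0" by simp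
    then show ?thesis by (subst LIMSEQ_iff_absval) simp
  qed
  from tendsto_affine[OF this, of c "-a"]
  have "(\<lambda>N. \<Sum>n<Suc N. fps_nth u n * a ^ n) \<longlonglongrightarrow> c" unfolding partial by simp
  then have "(\<lambda>n. fps_nth u n * a ^ n) sums c" unfolding sums_def by (rule LIMSEQ_imp_Suc)
  then show ?thesis by (simp add: entire_eval_def sums_iff)
qed

lemma entire_shift [intro]:
  assumes "(u :: 'a fps) \<in> entire_functions" shows "fps_shift m u \<in> entire_functions"
  unfolding entire_iff_bounded
proof (intro allI impI)
  fix r :: real assume r: "r > 0"
  obtain B where B: "B \<ge> 0" "\<And>n. absval (fps_nth u n) * r ^ n \<le> B" by (rule entire_boundedE[OF assms r]) blast
  show "\<exists>B. \<forall>n. absval (fps_nth (fps_shift m u) n) * r ^ n \<le> B"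
  proof (intro exI[of _ "B / r ^ m"] allI)
    fix n
    show "absval (fps_nth (fps_shift m u) n) * r ^ n \<le> B / r ^ m"
      using B(2)[of "n + m"] r by (simp add: pos_le_divide_eq power_add mult.assoc)
  qed
qed

lemma entire_division:
  assumes u: "(u :: 'a fps) \<in> entire_functions"
  obtains k where "k \<in> entire_functions" "u = fps_const (entire_eval u a) + (fps_X - fps_const a) * k"
proof -
  have rec: "entire_eval (fps_shift n u) a = fps_nth u n + a * entire_eval (fps_shift (Suc n) u) a" for n
  proof -
    have "(\<lambda>N. \<Sum>m<N. fps_nth (fps_shift (Suc n) u) m * a ^ m) \<longlonglongrightarrow> entire_eval (fps_shift (Suc n) u) a"
      using eval_sums[OF entire_shift[OF u, of "Suc n"], of a] unfolding sums_def .
    from tendsto_affine[OF this, of "fps_nth u n" a]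
    have "(\<lambda>N. \<Sum>m<Suc N. fps_nth (fps_shift n u) m * a ^ m) \<longlonglongrightarrow>
            fps_nth u n + a * entire_eval (fps_shift (Suc n) u) a"
      by (simp add: sum.lessThan_Suc_shift sum_distrib_left algebra_simps del: sum.lessThan_Suc)
    then have "(\<lambda>m. fps_nth (fps_shift n u) m * a ^ m) sums
        (fps_nth u n + a * entire_eval (fps_shift (Suc n) u) a)"
      unfolding sums_def by (rule LIMSEQ_imp_Suc)
    then show ?thesis unfolding entire_eval_def[of "fps_shift n u"] by (simp add: sums_iff)
  qed
  \<comment> \<open>Horner's scheme: the quotient has the coefficients \<open>\<Sum>\<^sub>m u\<^sub>m\<^sub>+\<^sub>n\<^sub>+\<^sub>1 a\<^sup>m\<close>.\<close>
  define k where "k = Abs_fps (\<lambda>n. entire_eval (fps_shift (Suc n) u) a)"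
  have "k \<in> entire_functions"
    unfolding entire_iff_bounded
  proof (intro allI impI)
    fix r :: real assume r: "r > 0"
    define R where "R = max r (absval a)"
    have R: "R > 0" "r \<le> R" "absval a \<le> R" using r by (auto simp: R_def)
    obtain B where B: "B \<ge> 0" "\<And>n. absval (fps_nth u n) * R ^ n \<le> B" by (rule entire_boundedE[OF u R(1)]) blast
    show "\<exists>B. \<forall>n. absval (fps_nth k n) * r ^ n \<le> B"
    proof (intro exI[of _ "B / R"] allI)
      fix n
      have "absval (fps_nth k n) \<le> B / R ^ Suc n"
        unfolding k_def fps_nth_Abs_fps
      proof (rule absval_eval_le[OF entire_shift[OF u] _ R(3)])
        fix m
        show "absval (fps_nth (fps_shift (Suc n) u) m) * R ^ m \<le> B / R ^ Suc n"
          using B(2)[of "Suc (m + n)"] R(1) by (simp add: field_simps power_add)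
      qed
      then have "absval (fps_nth k n) * r ^ n \<le> B / R ^ Suc n * R ^ n"
        using R B r by (intro mult_mono power_mono) auto
      also have "\<dots> = B / R" using R by simp
      finally show "absval (fps_nth k n) * r ^ n \<le> B / R" .
    qed
  qed
  moreover have "u = fps_const (entire_eval u a) + (fps_X - fps_const a) * k"
  proof (rule fps_ext)
    fix n
    show "fps_nth u n = fps_nth (fps_const (entire_eval u a) + (fps_X - fps_const a) * k) n"
      using rec[of n] by (cases n) (auto simp: left_diff_distrib k_def)
  qed
  ultimately show ?thesis using that by blast
qed

lemma eval_add [simp]:
  assumes "(u :: 'a fps) \<in> entire_functions" "v \<in> entire_functions"
  shows "entire_eval (u + v) a = entire_eval u a + entire_eval v a"
proof -
  obtain k where k: "k \<in> entire_functions" "u = fps_const (entire_eval u a) + (fps_X - fps_const a) * k"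
    by (rule entire_division[OF assms(1)])
  obtain l where l: "l \<in> entire_functions" "v = fps_const (entire_eval v a) + (fps_X - fps_const a) * l"
    by (rule entire_division[OF assms(2)])
  have "u + v = fps_const (entire_eval u a + entire_eval v a) + (fps_X - fps_const a) * (k + l)"
    by (subst k(2), subst l(2)) (simp add: algebra_simps flip: fps_const_add)
  then show ?thesis using k l by (intro eval_unique[of "k + l"]) auto
qed

lemma eval_mult [simp]:
  assumes "(u :: 'a fps) \<in> entire_functions" "v \<in> entire_functions"
  shows "entire_eval (u * v) a = entire_eval u a * entire_eval v a"
proof -
  obtain k where k: "k \<in> entire_functions" "u = fps_const (entire_eval u a) + (fps_X - fps_const a) * k"
    by (rule entire_division[OF assms(1)])
  obtain l where l: "l \<in> entire_functions" "v = fps_const (entire_eval v a) + (fps_X - fps_const a) * l"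
    by (rule entire_division[OF assms(2)])
  have "u * v = fps_const (entire_eval u a * entire_eval v a) +
      (fps_X - fps_const a) * (fps_const (entire_eval u a) * l + k * v)"
  proof -
    let ?b = "fps_const (entire_eval u a)" and ?c = "fps_const (entire_eval v a)"
      and ?t = "fps_X - fps_const a"
    have "u * v = (?b + ?t * k) * v" using k(2) by simp
    also have "\<dots> = ?b * v + ?t * (k * v)" by (simp add: algebra_simps)
    also have "?b * v = ?b * (?c + ?t * l)" using l(2) by simp
    finally show ?thesis by (simp add: algebra_simps flip: fps_const_mult)
  qed
  then show ?thesis using k l assms
    by (intro eval_unique[of "fps_const (entire_eval u a) * l + k * v"]) auto
qed

lemma eval_const [simp]: "entire_eval (fps_const (c :: 'a)) a = c"
  by (rule eval_unique[of 0]) auto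

lemma eval_X [simp]: "entire_eval (fps_X :: 'a fps) a = a"
  by (rule eval_unique[of 1]) auto

lemma eval_0 [simp]: "entire_eval (0 :: 'a fps) a = 0"
  using eval_const[of 0] by simp

lemma eval_1 [simp]: "entire_eval (1 :: 'a fps) a = 1"
  using eval_const[of 1] by simp

lemma eval_diff [simp]:
  assumes "(u :: 'a fps) \<in> entire_functions" "v \<in> entire_functions"
  shows "entire_eval (u - v) a = entire_eval u a - entire_eval v a"
  using eval_add[OF entire_diff[OF assms] assms(2), of a] by (simp add: algebra_simps)

lemma eval_power [simp]:
  "(u :: 'a fps) \<in> entire_functions \<Longrightarrow> entire_eval (u ^ n) a = entire_eval u a ^ n"
  by (induction n) (simp_all add: entire_power)

lemma eval_of_poly [simp]: "entire_eval (fps_of_poly q) a = poly (q :: 'a poly) a"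
  by (induction q) (simp_all add: fps_of_poly_pCons entire_mult algebra_simps)

lemma factor_at_zero:
  assumes "(u :: 'a fps) \<in> entire_functions" "entire_eval u a = 0"
  obtains k where "k \<in> entire_functions" "u = (fps_X - fps_const a) * k"
  using entire_division[OF assms(1), of a] assms(2) by auto

section \<open>Counting zeros by the dominant index\<close>

lemma dominant_index_exists:
  assumes u: "(u :: 'a fps) \<in> entire_functions" "u \<noteq> 0" and r: "r > 0"
  shows "\<exists>d. dominant_index r u d"
proof -
  let ?t = "\<lambda>n. absval (fps_nth u n) * r ^ n"
  obtain m where m: "fps_nth u m \<noteq> 0" using u(2) by (auto simp: fps_eq_iff)
  then have pos: "?t m > 0" using r by simp
  have "\<forall>\<^sub>F n in sequentially. ?t n < ?t m"
    using entire_terms_tendsto_0[OF u(1) r] pos by (auto simp: order_tendsto_iff)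
  then obtain N where N: "\<And>n. n \<ge> N \<Longrightarrow> ?t n < ?t m" by (auto simp: eventually_sequentially)
  then have mN: "m < N" by (meson less_irrefl not_less)
  define A where "A = Max (?t ` {..<N})"
  have "A \<in> ?t ` {..<N}" using mN unfolding A_def by (intro Max_in) auto
  have mA: "?t m \<le> A" using mN by (simp add: A_def)
  have le: "?t n \<le> A" for n
    using N[of n] mA by (cases "n < N") (auto simp: A_def)
  define S where "S = {n. ?t n = A}"
  have "S \<subseteq> {..<N}"
  proof
    fix n assume "n \<in> S"
    then show "n \<in> {..<N}" using N[of n] mA by (auto simp: S_def) (meson leD not_less)
  qed
  then have fin: "finite S" by (rule finite_subset) simp
  moreover have ne: "S \<noteq> {}" using \<open>A \<in> _\<close> by (auto simp: S_def)
  ultimately have d: "Max S \<in> S" by (rule Max_in)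
  then have dA: "?t (Max S) = A" by (simp add: S_def)
  have "?t n < A" if "n > Max S" for n
  proof -
    have "n \<notin> S" using that fin Max_ge[of S n] by (meson leD)
    then show ?thesis using le[of n] by (simp add: S_def)
  qed
  moreover have "fps_nth u (Max S) \<noteq> 0" using dA mA pos by (metis absval_zero leD mult_zero_left)
  ultimately have "dominant_index r u (Max S)"
    using le by (simp add: dominant_index_def dA)
  then show ?thesis ..
qed

text \<open>
This is Gauss's lemma: in the Cauchy product of \<open>u\<close> and \<open>v\<close> the strong triangle inequality lets only
\<open>u\<^sub>d v\<^sub>e\<close> reach the size of the product of the two maxima at an index \<open>\<ge> d + e\<close>.
\<close>

lemma dominant_index_mult:
  assumes u: "dominant_index r (u :: 'a fps) d" and v: "dominant_index r v e" and r: "r > 0"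
  shows "dominant_index r (u * v) (d + e)"
    and "absval (fps_nth (u * v) (d + e)) = absval (fps_nth u d) * absval (fps_nth v e)"
proof -
  define A where "A = absval (fps_nth u d) * r ^ d"
  define B where "B = absval (fps_nth v e) * r ^ e"
  have AB: "A > 0" "B > 0" using u v r by (simp_all add: A_def B_def dominant_index_def)
  note uD = dominant_indexD(2,3)[OF u, folded A_def]
  note vD = dominant_indexD(2,3)[OF v, folded B_def]
  have split: "absval (fps_nth u i * fps_nth v (n - i)) * r ^ n =
       (absval (fps_nth u i) * r ^ i) * (absval (fps_nth v (n - i)) * r ^ (n - i))"
    if "i \<le> n" for i n using that by (simp add: absval_mult flip: power_add)
  have term_le: "absval (fps_nth u i * fps_nth v (n - i)) \<le> A * B / r ^ n" if "i \<le> n" for i n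
  proof -
    have "absval (fps_nth u i * fps_nth v (n - i)) * r ^ n \<le> A * B"
      unfolding split[OF that] using uD vD AB r by (intro mult_mono) auto
    then show ?thesis using r by (simp add: pos_le_divide_eq)
  qed
  have term_less: "absval (fps_nth u i * fps_nth v (n - i)) < A * B / r ^ n"
    if "i \<le> n" "i > d \<or> n - i > e" for i n
  proof -
    have "absval (fps_nth u i * fps_nth v (n - i)) * r ^ n < A * B"
      unfolding split[OF that(1)]
    proof (cases "i > d")
      case True
      have "absval (fps_nth u i) * r ^ i * (absval (fps_nth v (n - i)) * r ^ (n - i)) \<le>
            absval (fps_nth u i) * r ^ i * B" using vD r by (intro mult_left_mono) auto
      also have "\<dots> < A * B" using uD(2)[OF True] AB by simp
      finally show "absval (fps_nth u i) * r ^ i * (absval (fps_nth v (n - i)) * r ^ (n - i)) < A * B" .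
    next
      case False
      have "absval (fps_nth u i) * r ^ i * (absval (fps_nth v (n - i)) * r ^ (n - i)) \<le>
            A * (absval (fps_nth v (n - i)) * r ^ (n - i))" using uD r by (intro mult_right_mono) auto
      also have "\<dots> < A * B" using vD(2)[of "n - i"] that False AB by simp
      finally show "absval (fps_nth u i) * r ^ i * (absval (fps_nth v (n - i)) * r ^ (n - i)) < A * B" .
    qed
    then show ?thesis using r by (simp add: pos_less_divide_eq)
  qed
  have bound: "absval (fps_nth (u * v) n) \<le> A * B / r ^ n" for n
    unfolding fps_mult_nth using AB r by (intro absval_sum_bound term_le) auto
  have bound_strict: "absval (fps_nth (u * v) n) < A * B / r ^ n" if "n > d + e" for n
    unfolding fps_mult_nth using AB r that by (intro absval_sum_less term_less) auto
  \<comment> \<open>The only summand of the coefficient \<open>d + e\<close> that has full size is the product of the two dominant coefficients.\<close>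
  have "fps_nth (u * v) (d + e) =
      fps_nth u d * fps_nth v e + (\<Sum>i\<in>{0..d + e} - {d}. fps_nth u i * fps_nth v (d + e - i))"
    unfolding fps_mult_nth by (subst sum.remove[of _ d]) auto
  moreover have "absval (\<Sum>i\<in>{0..d + e} - {d}. fps_nth u i * fps_nth v (d + e - i)) < A * B / r ^ (d + e)"
    using AB r by (intro absval_sum_less term_less) auto
  moreover have "A * B / r ^ (d + e) = absval (fps_nth u d * fps_nth v e)"
    using r by (simp add: A_def B_def power_add absval_mult)
  ultimately show eq: "absval (fps_nth (u * v) (d + e)) = absval (fps_nth u d) * absval (fps_nth v e)"
    using absval_add_eq by (simp add: absval_mult)
  then have eq': "absval (fps_nth (u * v) (d + e)) * r ^ (d + e) = A * B"
    by (simp add: A_def B_def power_add)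
  show "dominant_index r (u * v) (d + e)"
    unfolding dominant_index_def eq'
  proof (intro conjI allI impI)
    show "fps_nth (u * v) (d + e) \<noteq> 0" using eq' AB by auto
    show "absval (fps_nth (u * v) n) * r ^ n \<le> A * B" for n
      using bound[of n] r by (simp add: pos_le_divide_eq)
    show "absval (fps_nth (u * v) n) * r ^ n < A * B" if "n > d + e" for n
      using bound_strict[OF that] r by (simp add: pos_less_divide_eq)
  qed
qed

lemma dominant_index_perturb:
  assumes u: "dominant_index r (u :: 'a fps) d" and r: "r > 0"
    and close: "\<And>n. absval (fps_nth v n - fps_nth u n) * r ^ n \<le> B"
    and B: "B < absval (fps_nth u d) * r ^ d"
  shows "dominant_index r v d" "absval (fps_nth v d) = absval (fps_nth u d)"
proof -
  define A where "A = absval (fps_nth u d) * r ^ d"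
  have less: "absval (fps_nth v n - fps_nth u n) < A / r ^ n" for n
    using close[of n] B r by (simp add: A_def pos_less_divide_eq)
  have le: "absval (fps_nth v n) \<le> A / r ^ n" for n
    using absval_add_le[OF less_imp_le[OF less[of n]], of "fps_nth u n"]
      dominant_indexD(2)[OF u, of n] r by (simp add: A_def pos_le_divide_eq)
  have strict: "absval (fps_nth v n) < A / r ^ n" if "n > d" for n
    using absval_add_less[OF less[of n], of "fps_nth u n"]
      dominant_indexD(3)[OF u that] r by (simp add: A_def pos_less_divide_eq)
  have "absval (fps_nth v d - fps_nth u d) < absval (fps_nth u d)"
    using less[of d] r by (simp add: A_def)
  from absval_add_eq[OF this] show eq: "absval (fps_nth v d) = absval (fps_nth u d)" by simp
  then have "fps_nth v d \<noteq> 0" using dominant_indexD(1)[OF u] by (metis absval_eq_0_iff)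
  then show "dominant_index r v d"
    using le strict r unfolding dominant_index_def eq
    by (simp add: pos_le_divide_eq pos_less_divide_eq flip: A_def)
qed

text \<open>
Dividing out a zero in the disc lowers the dominant index by one; this drives all the inductions on
it below.
\<close>

lemma dominant_index_factor:
  assumes k: "(k :: 'a fps) \<in> entire_functions" and r: "r > 0" and a: "absval a \<le> r"
    and d: "dominant_index r ((fps_X - fps_const a) * k) d"
  obtains e where "d = Suc e" "dominant_index r k e"
proof -
  have "k \<noteq> 0" using d by (auto simp: dominant_index_def)
  then obtain e where e: "dominant_index r k e" using dominant_index_exists[OF k _ r] by blast
  have "dominant_index r (fps_X - fps_const a) 1"
    using dominant_index_linear[OF r, of a] a by simp
  from dominant_index_mult(1)[OF this e r] d have "d = Suc e"
    using dominant_index_unique by fastforce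
  with e show ?thesis using that by blast
qed

lemma eval_nonzero_if_dominant_index_0:
  assumes "(u :: 'a fps) \<in> entire_functions" "r > 0" "dominant_index r u 0" "absval a \<le> r"
  shows "entire_eval u a \<noteq> 0"
proof
  assume "entire_eval u a = 0"
  then obtain k where k: "k \<in> entire_functions" "u = (fps_X - fps_const a) * k"
    by (rule factor_at_zero[OF assms(1)])
  from dominant_index_factor[OF k(1) assms(2,4)] assms(3) k(2) show False by blast
qed

lemma finite_zeros_in_disc:
  assumes "(u :: 'a fps) \<in> entire_functions" "u \<noteq> 0" "r > 0"
  shows "finite {a. absval a \<le> r \<and> entire_eval u a = 0}"
proof -
  obtain d where "dominant_index r u d" using dominant_index_exists[OF assms] by blast
  then show ?thesis using assms(1)
  proof (induction d arbitrary: u)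
    case 0
    then have "{a. absval a \<le> r \<and> entire_eval u a = 0} = {}"
      using eval_nonzero_if_dominant_index_0[OF _ assms(3)] by blast
    then show ?case by (metis finite.emptyI)
  next
    case (Suc d)
    show ?case
    proof (cases "\<exists>a. absval a \<le> r \<and> entire_eval u a = 0")
      case True
      then obtain a where a: "absval a \<le> r" "entire_eval u a = 0" by blast
      then obtain k where k: "k \<in> entire_functions" "u = (fps_X - fps_const a) * k"
        by (meson factor_at_zero[OF Suc.prems(2)])
      then have "dominant_index r k d"
        using dominant_index_factor[OF k(1) assms(3) a(1)] Suc.prems(1) by blast
      then have "finite {a. absval a \<le> r \<and> entire_eval k a = 0}" using Suc.IH k by blast
      moreover have "{a. absval a \<le> r \<and> entire_eval u a = 0} \<subseteq>
          insert a {a. absval a \<le> r \<and> entire_eval k a = 0}"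
        using k by (auto simp: entire_diff)
      ultimately show ?thesis by (meson finite_insert finite_subset)
    next
      case False
      then have "{a. absval a \<le> r \<and> entire_eval u a = 0} = {}" by blast
      then show ?thesis by (metis finite.emptyI)
    qed
  qed
qed

lemma infinite_unit_disc: "infinite {x::'a. absval x \<le> 1}"
proof -
  have "range of_nat \<subseteq> {x::'a. absval x \<le> 1}" using absval_of_nat_le by auto
  moreover have "infinite (range (of_nat :: nat \<Rightarrow> 'a))"
    using range_inj_infinite[OF inj_of_nat] by blast
  ultimately show ?thesis using finite_subset by blast
qed

lemma entire_eqI:
  assumes "(u :: 'a fps) \<in> entire_functions" "v \<in> entire_functions"
    and "\<And>x. entire_eval u x = entire_eval v x"
  shows "u = v"
proof (rule ccontr)
  assume "u \<noteq> v"
  then have "finite {a. absval a \<le> 1 \<and> entire_eval (u - v) a = 0}"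
    using assms by (intro finite_zeros_in_disc) auto
  then show False using assms infinite_unit_disc by simp
qed

section \<open>Zeros as limits of roots\<close>

text \<open>
These polynomials are power series, so that they can be compared with an entire function
coefficient by coefficient.
\<close>

definition split_series :: "'a \<Rightarrow> 'a list \<Rightarrow> 'a fps" where
  "split_series c zs = fps_const c * (\<Prod>z\<leftarrow>zs. fps_X - fps_const z)"

lemma split_series_Nil: "split_series c [] = fps_const c"
  by (simp add: split_series_def)

lemma split_series_Cons: "split_series c (z # zs) = (fps_X - fps_const z) * split_series c zs"
  by (simp add: split_series_def mult_ac)

lemma entire_split_series [simp, intro]: "split_series c zs \<in> entire_functions"
  by (induction zs) (auto simp: split_series_Nil split_series_Cons)

lemma split_series_nonzero: "c \<noteq> 0 \<Longrightarrow> split_series c zs \<noteq> 0"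
proof (induction zs)
  case (Cons z zs)
  have "(fps_X - fps_const z) \<noteq> (0 :: 'a fps)"
    using dominant_index_linear[of 1 z] by (auto simp: dominant_index_def)
  with Cons show ?case by (simp add: split_series_Cons)
qed (simp add: split_series_Nil)

lemma eval_split_series_root: "z \<in> set zs \<Longrightarrow> entire_eval (split_series c zs) z = 0"
  by (induction zs) (auto simp: split_series_Cons entire_diff)

text \<open>
For \<open>\<bar>x\<bar> \<le> r\<close> a factor \<open>x - z\<close> with \<open>\<bar>z\<bar> > r\<close> has the size \<open>\<bar>z\<bar>\<close> that it contributes to the dominant
coefficient, and each of the remaining \<open>d\<close> factors is at least \<open>\<rho>\<close>.  Read contrapositively: where the
polynomial is small, a root is near.
\<close>

lemma split_series_lower_bound:
  assumes "c \<noteq> 0" "r > 0" "\<rho> \<ge> 0" "absval x \<le> r"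
    and "\<And>z. z \<in> set zs \<Longrightarrow> absval z \<le> r \<Longrightarrow> \<rho> \<le> absval (x - z)"
    and "dominant_index r (split_series c zs) d"
  shows "absval (fps_nth (split_series c zs) d) * \<rho> ^ d \<le> absval (entire_eval (split_series c zs) x)"
  using assms(5,6)
proof (induction zs arbitrary: d)
  case Nil
  then have "d = 0" using dominant_index_unique dominant_index_const[OF assms(1)]
    by (metis split_series_Nil)
  then show ?case by (simp add: split_series_Nil)
next
  case (Cons z zs)
  obtain e where e: "dominant_index r (split_series c zs) e"
    using dominant_index_exists[OF entire_split_series split_series_nonzero[OF assms(1)] assms(2)] by blast
  have IH: "absval (fps_nth (split_series c zs) e) * \<rho> ^ e \<le> absval (entire_eval (split_series c zs) x)"
    using Cons.IH[OF _ e] Cons.prems(1) by simp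
  have eval: "absval (entire_eval (split_series c (z # zs)) x) =
      absval (x - z) * absval (entire_eval (split_series c zs) x)"
    by (simp add: split_series_Cons absval_mult entire_diff)
  note m = dominant_index_mult[OF dominant_index_linear[OF assms(2), of z] e assms(2), folded split_series_Cons]
  then have d: "d = (if absval z \<le> r then 1 else 0) + e"
    using dominant_index_unique Cons.prems(2) by blast
  show ?case
  proof (cases "absval z \<le> r")
    case True
    then have "absval (fps_nth (split_series c (z # zs)) d) * \<rho> ^ d =
        \<rho> * (absval (fps_nth (split_series c zs) e) * \<rho> ^ e)" using m(2) by (simp add: d)
    also have "\<dots> \<le> absval (x - z) * absval (entire_eval (split_series c zs) x)"
      using IH Cons.prems(1)[of z] True assms(3) by (intro mult_mono) auto
    finally show ?thesis using eval by simp
  next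
    case False
    have "absval (x - z) = absval z"
      using absval_add_eq[of x "- z"] False assms(4) by simp
    then show ?thesis using m(2) IH False eval by (simp add: d mult.assoc mult_left_mono)
  qed
qed

text \<open>
If \<open>x\<close> is a root of one approximant, the next approximant is small at \<open>x\<close> and has by
\<open>split_series_lower_bound\<close> a root near \<open>x\<close>.  Continuing in this way gives a convergent sequence of
roots, whose limit is a zero of \<open>u\<close>.
\<close>

lemma zero_if_limit_of_split_series:
  assumes u: "(u :: 'a fps) \<in> entire_functions" and r: "r > 0"
    and d: "dominant_index r u d" "d > 0"
    and approx: "\<And>\<epsilon>. \<epsilon> > 0 \<Longrightarrow>
      \<exists>c zs. c \<noteq> 0 \<and> (\<forall>n. absval (fps_nth (split_series c zs) n - fps_nth u n) * r ^ n \<le> \<epsilon>)"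
  shows "\<exists>a. absval a \<le> r \<and> entire_eval u a = 0"
proof -
  define A where "A = absval (fps_nth u d) * r ^ d"
  have A: "A > 0" using d r by (simp add: A_def dominant_index_def)
  \<comment> \<open>The precision \<open>\<epsilon> k\<close> makes successive roots differ by less than \<open>r / 2\<^sup>k\<close>: the \<open>d\<close> roots in the disc
    share the small value, so at least one of the \<open>d\<close> distances is at most its \<open>d\<close>-th root.\<close>
  define \<epsilon> where "\<epsilon> k = A * ((1/2) ^ Suc k) ^ d" for k
  have \<epsilon>_pos: "\<epsilon> k > 0" for k using A by (simp add: \<epsilon>_def)
  have \<epsilon>_less: "\<epsilon> k < A * ((1/2) ^ k) ^ d" for k
    unfolding \<epsilon>_def using A d by (intro mult_strict_left_mono power_strict_mono) auto
  have "((1/2) ^ k) ^ d \<le> (1::real)" for k by (intro power_le_one) auto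
  then have "A * ((1/2) ^ k) ^ d \<le> A" for k using A by simp
  then have \<epsilon>_A: "\<epsilon> k < A" for k using \<epsilon>_less[of k] less_le_trans by blast
  have \<epsilon>_Suc: "\<epsilon> (Suc k) \<le> \<epsilon> k" for k
    unfolding \<epsilon>_def using A by (intro mult_left_mono power_mono power_decreasing) auto
  have "\<forall>k. \<exists>c zs. c \<noteq> 0 \<and> (\<forall>n. absval (fps_nth (split_series c zs) n - fps_nth u n) * r ^ n \<le> \<epsilon> k)"
    using approx \<epsilon>_pos by blast
  then obtain c zs where c: "\<And>k. c k \<noteq> 0" and
    close: "\<And>k n. absval (fps_nth (split_series (c k) (zs k)) n - fps_nth u n) * r ^ n \<le> \<epsilon> k"
    by metis
  define q where "q k = split_series (c k) (zs k)" for k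
  have q [simp, intro]: "q k \<in> entire_functions" for k by (simp add: q_def)
  have close: "absval (fps_nth (q k) n - fps_nth u n) \<le> \<epsilon> k / r ^ n" for k n
    using close[of k n] r by (simp add: q_def pos_le_divide_eq)
  have dom: "dominant_index r (q k) d" and q_d: "absval (fps_nth (q k) d) = absval (fps_nth u d)" for k
    using dominant_index_perturb[OF d(1) r, of "q k" "\<epsilon> k"] close[of k] \<epsilon>_A[of k] r
    by (simp_all add: A_def pos_le_divide_eq)
  have q_le: "absval (fps_nth (q k) n) * r ^ n \<le> A" for k n
    using dominant_indexD(2)[OF dom, of k n] by (simp add: q_d A_def)
  have near_root: "\<exists>z. absval z \<le> r \<and> entire_eval (q k) z = 0 \<and> absval (x - z) < \<rho>"
    if "absval x \<le> r" "\<rho> \<ge> 0" "absval (entire_eval (q k) x) < absval (fps_nth u d) * \<rho> ^ d" for k x \<rho>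
  proof (rule ccontr)
    assume "\<not> ?thesis"
    then have "absval (fps_nth (q k) d) * \<rho> ^ d \<le> absval (entire_eval (q k) x)"
      unfolding q_def using that dom[of k, unfolded q_def] eval_split_series_root
      by (intro split_series_lower_bound[OF c r]) (auto simp: not_less)
    then show False using that(3) q_d by simp
  qed
  define P where "P k x \<longleftrightarrow> absval x \<le> r \<and> entire_eval (q k) x = 0" for k x
  have "\<exists>x. P 0 x"
  proof -
    have "absval (entire_eval (q 0) 0) \<le> A"
      using r by (intro absval_eval_le[OF q q_le]) auto
    \<comment> \<open>With \<open>\<rho> = 2 r\<close> the lower bound exceeds every value on the disc, so the disc contains a root at all.\<close>
    also have "A < A * 2 ^ d" using A d(2) by simp
    also have "A * 2 ^ d = absval (fps_nth u d) * (2 * r) ^ d" by (simp add: A_def power_mult_distrib)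
    finally show ?thesis using near_root[of 0 "2 * r" 0] r by (auto simp: P_def)
  qed
  moreover have "\<exists>y. P (Suc k) y \<and> absval (x - y) \<le> r * (1/2) ^ k" if "P k x" for k x
  proof -
    have x: "absval x \<le> r" "entire_eval (q k) x = 0" using that by (auto simp: P_def)
    have "absval (entire_eval (q (Suc k)) x) = absval (entire_eval (q (Suc k) - q k) x)"
      using x by simp
    also have "\<dots> \<le> \<epsilon> k"
    proof (rule absval_eval_le[OF _ _ x(1)])
      fix n
      have "absval (fps_nth (q (Suc k)) n - fps_nth u n) \<le> \<epsilon> k / r ^ n"
        using close[of "Suc k" n] \<epsilon>_Suc[of k] r by (smt (verit) divide_right_mono zero_le_power)
      from absval_diff_le[OF this close[of k n]]
      show "absval (fps_nth (q (Suc k) - q k) n) * r ^ n \<le> \<epsilon> k"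
        using r by (simp add: pos_le_divide_eq)
    qed auto
    also have "\<dots> < absval (fps_nth u d) * (r * (1/2) ^ k) ^ d"
      using \<epsilon>_less[of k] by (simp add: A_def power_mult_distrib)
    finally show ?thesis using near_root[OF x(1), of "r * (1/2) ^ k" "Suc k"] r
      by (auto simp: P_def intro: less_imp_le)
  qed
  ultimately have "\<exists>x. \<forall>k. P k (x k) \<and> absval (x k - x (Suc k)) \<le> r * (1/2) ^ k"
    by (rule dependent_nat_choice)
  then obtain x where x: "\<And>k. P k (x k)" "\<And>k. absval (x k - x (Suc k)) \<le> r * (1/2) ^ k"
    by blast
  have "\<exists>l. x \<longlonglongrightarrow> l"
  proof (rule convergent_if_increments_small)
    show "absval (x (Suc k) - x k) \<le> r * (1/2) ^ k" for k
      using x(2)[of k] by (simp add: absval_minus_commute)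
    show "decseq (\<lambda>k. r * (1/2) ^ k)"
      using r by (intro decseq_SucI) simp
    show "(\<lambda>k. r * (1/2) ^ k) \<longlonglongrightarrow> 0"
      by (intro tendsto_mult_right_zero LIMSEQ_realpow_zero) auto
  qed
  then obtain l where l: "x \<longlonglongrightarrow> l" by blast
  have lr: "absval l \<le> r" using lim_absval_le[OF l] x(1) by (auto simp: P_def)
  obtain k where k: "k \<in> entire_functions" "u = fps_const (entire_eval u l) + (fps_X - fps_const l) * k"
    by (rule entire_division[OF u])
  obtain C where C: "C \<ge> 0" "\<And>x. absval x \<le> r \<Longrightarrow> absval (entire_eval k x) \<le> C"
    using eval_bounded_on_disc[OF k(1), of r] by blast
  have "absval (entire_eval u l) \<le> \<epsilon> n + C * absval (x n - l)" for n
  proof -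
    have xr: "absval (x n) \<le> r" using x(1) by (simp add: P_def)
    have "entire_eval u (x n) = entire_eval u l + (x n - l) * entire_eval k (x n)"
      using k(1) by (subst k(2)) (simp add: entire_diff entire_mult)
    then have "entire_eval u l = entire_eval u (x n) + (l - x n) * entire_eval k (x n)"
      by (simp add: algebra_simps)
    also have "absval \<dots> \<le> absval (entire_eval u (x n)) + absval (l - x n) * absval (entire_eval k (x n))"
      using absval_triangle by (simp flip: absval_mult)
    also have "absval (entire_eval u (x n)) = absval (entire_eval (q n - u) (x n))"
      using x(1)[of n] u by (simp add: P_def)
    also have "\<dots> \<le> \<epsilon> n"
      using close[of n] r by (intro absval_eval_le[OF _ _ xr]) (auto simp: u pos_le_divide_eq)
    also have "absval (l - x n) * absval (entire_eval k (x n)) \<le> absval (l - x n) * C"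
      using C(2)[OF xr] by (intro mult_left_mono) auto
    finally show ?thesis by (simp add: absval_minus_commute mult.commute)
  qed
  moreover have "(\<lambda>n. \<epsilon> n + C * absval (x n - l)) \<longlonglongrightarrow> 0"
  proof -
    have "(\<lambda>n. (1/2) ^ Suc n :: real) \<longlonglongrightarrow> 0" by (intro LIMSEQ_Suc LIMSEQ_realpow_zero) auto
    then have "(\<lambda>n. A * ((1/2) ^ Suc n) ^ d + C * absval (x n - l)) \<longlonglongrightarrow> A * 0 ^ d + C * 0"
      using l by (intro tendsto_intros) (simp_all add: LIMSEQ_iff_absval)
    then show ?thesis using d(2) by (simp add: \<epsilon>_def zero_power)
  qed
  ultimately have "absval (entire_eval u l) \<le> 0" by (intro LIMSEQ_le_const) auto
  then have "entire_eval u l = 0" using absval_nonneg absval_eq_0_iff order_antisym by blast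
  with lr show ?thesis by blast
qed

lemma poly_splits_if_roots:
  assumes "\<And>q :: 'a poly. 0 < degree q \<Longrightarrow> degree q \<le> m \<Longrightarrow> \<exists>x. poly q x = 0"
    and "degree q \<le> m" "q \<noteq> 0"
  shows "\<exists>c zs. c \<noteq> 0 \<and> fps_of_poly q = split_series c zs"
  using assms(2,3)
proof (induction "degree q" arbitrary: q)
  case 0
  then obtain c where "q = [:c:]" using degree_eq_zeroE by (metis)
  with 0 show ?case
    by (intro exI[of _ c] exI[of _ "[]"]) (simp add: split_series_Nil fps_of_poly_const)
next
  case (Suc n)
  then obtain z where "poly q z = 0" using assms(1)[of q] by auto
  then obtain q' where q': "q = [:-z, 1:] * q'" by (auto simp: poly_eq_0_iff_dvd)
  then have "q' \<noteq> 0" using Suc by auto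
  then have "degree q = Suc (degree q')" unfolding q' by (subst degree_mult_eq) auto
  then obtain c zs where c: "c \<noteq> 0" "fps_of_poly q' = split_series c zs"
    using Suc.hyps(1)[of q'] Suc.hyps(2) Suc.prems \<open>q' \<noteq> 0\<close> by auto
  moreover have "fps_of_poly [:-z, 1:] = fps_X - fps_const z"
    by (simp add: fps_of_poly_linear)
  ultimately have "fps_of_poly q = split_series c (z # zs)"
    by (simp only: q' fps_of_poly_mult split_series_Cons)
  then show ?case using c by blast
qed

text \<open>
This is how the completion of an algebraically closed field is algebraically closed: a polynomial
is approximated by polynomials with coefficients in \<open>D\<close>.  By induction on the degree the
approximants split completely.
\<close>

lemma poly_root_if_dense_coefficients:
  fixes D :: "'a set"
  assumes "closure D = UNIV" "0 \<in> D"
    and "\<And>q. 0 < degree q \<Longrightarrow> (\<forall>i. coeff q i \<in> D) \<Longrightarrow> \<exists>x. poly q x = 0"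
  shows "0 < degree (q :: 'a poly) \<Longrightarrow> \<exists>x. poly q x = 0"
proof (induction "degree q" arbitrary: q rule: less_induct)
  case less
  define n where "n = degree q"
  have n: "n > 0" using less.prems by (simp add: n_def)
  have "q \<noteq> 0" using less.prems by auto
  \<comment> \<open>A radius so large that the leading coefficient dominates.\<close>
  define r where "r = 1 + (\<Sum>i<n. absval (coeff q i)) / absval (lead_coeff q)"
  have r1: "r \<ge> 1" by (simp add: r_def sum_nonneg)
  have dom: "dominant_index r (fps_of_poly q) n"
    unfolding dominant_index_def
  proof (intro conjI allI impI)
    show "fps_nth (fps_of_poly q) n \<noteq> 0" using \<open>q \<noteq> 0\<close> by (simp add: n_def)
    fix i
    show "absval (fps_nth (fps_of_poly q) i) * r ^ i < absval (fps_nth (fps_of_poly q) n) * r ^ n" if "i > n"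
      using that \<open>q \<noteq> 0\<close> r1 by (simp add: n_def coeff_eq_0)
    show "absval (fps_nth (fps_of_poly q) i) * r ^ i \<le> absval (fps_nth (fps_of_poly q) n) * r ^ n"
    proof (cases "i < n")
      case True
      have "absval (coeff q i) \<le> (\<Sum>i<n. absval (coeff q i))"
        using True by (intro member_le_sum) auto
      also have "\<dots> \<le> absval (coeff q n) * r"
        using \<open>q \<noteq> 0\<close> by (simp add: r_def n_def distrib_left)
      finally have "absval (coeff q i) * r ^ i \<le> absval (coeff q n) * r * r ^ i"
        using r1 by (intro mult_right_mono) auto
      also have "\<dots> = absval (coeff q n) * r ^ Suc i" by simp
      also have "\<dots> \<le> absval (coeff q n) * r ^ n"
        using True r1 by (intro mult_left_mono power_increasing) auto
      finally show ?thesis by simp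
    next
      case False
      then show ?thesis using r1 by (cases "i = n") (auto simp: n_def coeff_eq_0)
    qed
  qed
  have "\<exists>a. absval a \<le> r \<and> entire_eval (fps_of_poly q) a = 0"
  proof (rule zero_if_limit_of_split_series[OF _ _ dom n])
    fix \<epsilon> :: real assume \<epsilon>: "\<epsilon> > 0"
    define \<delta> where "\<delta> = min \<epsilon> (absval (coeff q n) / 2)"
    have \<delta>: "\<delta> > 0" "\<delta> \<le> \<epsilon>" "\<delta> < absval (coeff q n)"
      using \<epsilon> \<open>q \<noteq> 0\<close> by (auto simp: \<delta>_def n_def min_def)
    have "\<exists>y\<in>D. absval (y - coeff q i) < \<delta> / r ^ n" for i
    proof -
      have "coeff q i \<in> closure D" using assms(1) by simp
      moreover have "\<delta> / r ^ n > 0" using \<delta> r1 by simp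
      ultimately show ?thesis unfolding closure_approachable dist_absval by blast
    qed
    then obtain y where y: "\<And>i. y i \<in> D" "\<And>i. absval (y i - coeff q i) < \<delta> / r ^ n" by metis
    define g where "g = (\<Sum>i\<le>n. monom (y i) i)"
    have coeff_g: "coeff g i = (if i \<le> n then y i else 0)" for i
      by (simp add: g_def coeff_sum)
    have "\<delta> / r ^ n \<le> \<delta>" using \<delta> r1 by (simp add: field_simps)
    then have "absval (y n - coeff q n) < absval (coeff q n)" using y(2)[of n] \<delta> by linarith
    then have "y n \<noteq> 0" by auto
    then have "degree g = n"
      by (intro antisym degree_le le_degree) (auto simp: coeff_g)
    \<comment> \<open>The approximant \<open>g\<close> has a root because its coefficients lie in \<open>D\<close>.  The cofactor need not have
      coefficients in \<open>D\<close>, but it has smaller degree and splits by the induction hypothesis.\<close>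
    then obtain z where "poly g z = 0"
      using assms(3)[of g] n y(1) assms(2) by (metis coeff_g)
    then obtain g' where g': "g = [:-z, 1:] * g'" by (auto simp: poly_eq_0_iff_dvd)
    have "g' \<noteq> 0" using g' \<open>degree g = n\<close> n by auto
    then have "degree g = Suc (degree g')" unfolding g' by (subst degree_mult_eq) auto
    then have "\<exists>c zs. c \<noteq> 0 \<and> fps_of_poly g' = split_series c zs"
      using less.hyps \<open>degree g = n\<close> \<open>g' \<noteq> 0\<close>
      by (intro poly_splits_if_roots[of "degree g'"]) (auto simp: n_def)
    then obtain c zs where c: "c \<noteq> 0" "fps_of_poly g' = split_series c zs" by blast
    moreover have "fps_of_poly [:-z, 1:] = fps_X - fps_const z"
      by (simp add: fps_of_poly_linear)
    ultimately have g_split: "fps_of_poly g = split_series c (z # zs)"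
      by (simp only: g' fps_of_poly_mult split_series_Cons)
    have "absval (fps_nth (fps_of_poly g) i - fps_nth (fps_of_poly q) i) * r ^ i \<le> \<epsilon>" for i
    proof (cases "i \<le> n")
      case True
      have "absval (y i - coeff q i) * r ^ i \<le> \<delta> / r ^ n * r ^ n"
        using y(2)[of i] True r1 \<delta>(1) by (intro mult_mono power_increasing) (auto intro: less_imp_le)
      also have "\<dots> = \<delta>" using r1 by simp
      finally show ?thesis using True \<delta> by (simp add: coeff_g)
    next
      case False
      then show ?thesis using \<epsilon> by (simp add: coeff_g n_def coeff_eq_0)
    qed
    then show "\<exists>c zs. c \<noteq> 0 \<and>
        (\<forall>i. absval (fps_nth (split_series c zs) i - fps_nth (fps_of_poly q) i) * r ^ i \<le> \<epsilon>)"
      using c(1) g_split by metis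
  qed (use r1 in auto)
  then show ?case by auto
qed

end

section \<open>Entire functions over an algebraically closed field\<close>

locale algebraically_closed_nonarchimedean = nonarchimedean K for K :: "'a :: valued_field_char_0 itself" +
  assumes poly_root: "0 < degree (q :: 'a poly) \<Longrightarrow> \<exists>x. poly q x = 0"
begin

text \<open>
The approximating polynomials are the truncations of \<open>u\<close>.
\<close>

lemma zero_if_dominant_index_pos:
  assumes u: "(u :: 'a fps) \<in> entire_functions" and r: "r > 0"
    and d: "dominant_index r u d" "d > 0"
  obtains a where "absval a \<le> r" "entire_eval u a = 0"
proof -
  have "\<exists>a. absval a \<le> r \<and> entire_eval u a = 0"
  proof (rule zero_if_limit_of_split_series[OF u r d])
    fix \<epsilon> :: real assume \<epsilon>: "\<epsilon> > 0"
    then have "\<forall>\<^sub>F n in sequentially. absval (fps_nth u n) * r ^ n < \<epsilon>"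
      using entire_terms_tendsto_0[OF u r] by (auto simp: order_tendsto_iff)
    then obtain N where N: "\<And>n. n \<ge> N \<Longrightarrow> absval (fps_nth u n) * r ^ n < \<epsilon>"
      by (auto simp: eventually_sequentially)
    \<comment> \<open>Truncating after the index \<open>d\<close> keeps the polynomial nonzero.\<close>
    define q where "q = (\<Sum>i\<le>max N d. monom (fps_nth u i) i)"
    have coeff_q: "coeff q i = (if i \<le> max N d then fps_nth u i else 0)" for i
      by (simp add: q_def coeff_sum)
    have "coeff q d \<noteq> 0" using dominant_indexD(1)[OF d(1)] by (simp add: coeff_q)
    then have "q \<noteq> 0" by auto
    then obtain c zs where "c \<noteq> 0" "fps_of_poly q = split_series c zs"
      using poly_splits_if_roots[of "degree q" q] poly_root by blast
    moreover have "absval (fps_nth (fps_of_poly q) n - fps_nth u n) * r ^ n \<le> \<epsilon>" for n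
      using less_imp_le[OF N[of n]] \<epsilon> by (auto simp: coeff_q)
    ultimately show "\<exists>c zs. c \<noteq> 0 \<and>
        (\<forall>n. absval (fps_nth (split_series c zs) n - fps_nth u n) * r ^ n \<le> \<epsilon>)"
      by metis
  qed
  then show ?thesis using that by blast
qed

text \<open>
Without zeros the dominant index is \<open>0\<close> for every radius, so \<open>\<bar>u\<^sub>n\<bar> r\<^sup>n < \<bar>u\<^sub>0\<bar>\<close> for all \<open>n > 0\<close> and
all \<open>r\<close>.
\<close>

lemma constant_if_no_zero:
  assumes u: "(u :: 'a fps) \<in> entire_functions" "\<And>x. entire_eval u x \<noteq> 0"
  shows "u \<in> range fps_const"
proof -
  have "u \<noteq> 0" using u(2)[of 0] by auto
  have dom: "dominant_index r u 0" if r: "r > 0" for r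
  proof -
    obtain d where d: "dominant_index r u d" using dominant_index_exists[OF u(1) \<open>u \<noteq> 0\<close> r] by blast
    moreover have "d = 0"
      using zero_if_dominant_index_pos[OF u(1) r d] u(2) by blast
    ultimately show ?thesis by simp
  qed
  have "fps_nth u n = 0" if n: "n > 0" for n
  proof (rule ccontr)
    assume nz: "fps_nth u n \<noteq> 0"
    \<comment> \<open>At this radius the \<open>n\<close>-th term is at least as large as the constant term.\<close>
    define r where "r = 1 + absval (fps_nth u 0) / absval (fps_nth u n)"
    have r1: "r \<ge> 1" by (simp add: r_def)
    have "absval (fps_nth u 0) \<le> absval (fps_nth u n) * r"
      using nz by (simp add: r_def distrib_left)
    also have "\<dots> \<le> absval (fps_nth u n) * r ^ n"
      using r1 n by (intro mult_left_mono) (auto intro: self_le_power)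
    also have "\<dots> < absval (fps_nth u 0)"
      using dominant_indexD(3)[OF dom[of r], of n] r1 n by simp
    finally show False by simp
  qed
  then have "u = fps_const (fps_nth u 0)" by (auto simp: fps_eq_iff)
  then show ?thesis by blast
qed

lemma entire_surjective:
  assumes "(u :: 'a fps) \<in> entire_functions" "u \<notin> range fps_const"
  obtains x where "entire_eval u x = c"
proof -
  have "\<exists>x. entire_eval u x = c"
  proof (rule ccontr)
    assume "\<not> ?thesis"
    then have "u - fps_const c \<in> range fps_const"
      using assms(1) by (intro constant_if_no_zero) auto
    then obtain d where "u - fps_const c = fps_const d" by blast
    then have "u = fps_const (c + d)" by (simp add: algebra_simps flip: fps_const_add)
    then show False using assms(2) by blast
  qed
  then show ?thesis using that by blast
qed

lemma fps_const_range_subset_poly: "range fps_const \<subseteq> range (fps_of_poly :: 'a poly \<Rightarrow> _)"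
  by (metis fps_of_poly_const image_subsetI rangeI)

text \<open>
Dividing out the zeros one by one leaves a function without zeros, which is constant.
\<close>

lemma polynomial_if_finitely_many_zeros:
  assumes u: "(u :: 'a fps) \<in> entire_functions" "u \<noteq> 0" and fin: "finite {a. entire_eval u a = 0}"
  shows "u \<in> range fps_of_poly"
proof -
  define r where "r = 1 + (\<Sum>a | entire_eval u a = 0. absval a)"
  have r: "r > 0" by (simp add: r_def add_pos_nonneg sum_nonneg)
  have zeros: "absval a \<le> r" if "entire_eval u a = 0" for a
  proof -
    have "absval a \<le> (\<Sum>a | entire_eval u a = 0. absval a)"
      using that fin by (intro member_le_sum) auto
    then show ?thesis by (simp add: r_def)
  qed
  obtain d where "dominant_index r u d" using dominant_index_exists[OF u r] by blast
  then show ?thesis using u(1) zeros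
  proof (induction d arbitrary: u)
    case 0
    then have "u \<in> range fps_const"
      using eval_nonzero_if_dominant_index_0[OF _ r] by (intro constant_if_no_zero) blast+
    then show ?case using fps_const_range_subset_poly by blast
  next
    case (Suc d)
    then obtain a where a: "absval a \<le> r" "entire_eval u a = 0"
      using zero_if_dominant_index_pos[OF _ r] by blast
    obtain k where k: "k \<in> entire_functions" "u = (fps_X - fps_const a) * k"
      by (rule factor_at_zero[OF Suc.prems(2) a(2)])
    have "dominant_index r k d"
      using dominant_index_factor[OF k(1) r a(1)] Suc.prems(1) k(2) by blast
    moreover have "absval x \<le> r" if "entire_eval k x = 0" for x
      using that k Suc.prems(3)[of x] by (simp add: entire_diff)
    ultimately obtain q where "k = fps_of_poly q" using Suc.IH k(1) by blast
    then have "u = fps_of_poly ([:-a, 1:] * q)"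
      by (simp add: k(2) fps_of_poly_mult fps_of_poly_linear del: mult_pCons_left)
    then show ?case by blast
  qed
qed

lemma infinitely_many_preimages:
  assumes "(u :: 'a fps) \<in> entire_functions" "u \<notin> range fps_of_poly"
  shows "infinite {a. entire_eval u a = c}"
proof
  assume "finite {a. entire_eval u a = c}"
  moreover have "{a. entire_eval (u - fps_const c) a = 0} = {a. entire_eval u a = c}"
    using assms(1) by simp
  moreover have ne: "u - fps_const c \<noteq> 0" using assms(2) fps_const_range_subset_poly by auto
  ultimately have "u - fps_const c \<in> range fps_of_poly"
    using assms(1) by (intro polynomial_if_finitely_many_zeros) auto
  then obtain q where "u - fps_const c = fps_of_poly q" by blast
  then have "u = fps_of_poly (q + [:c:])"
    by (simp add: fps_of_poly_add fps_of_poly_const algebra_simps)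
  then show False using assms(2) by blast
qed

text \<open>
Liouville's theorem: a nonconstant entire function takes every value, in particular one that is too
large.  The bound is only required outside a disc around \<open>b\<close>, which is the form used at infinity.
\<close>

lemma constant_if_bounded:
  assumes u: "(u :: 'a fps) \<in> entire_functions"
    and bound: "\<And>y. absval (y - b) > R \<Longrightarrow> absval (entire_eval u y) \<le> M"
  shows "u \<in> range fps_const"
proof (rule ccontr)
  assume nc: "u \<notin> range fps_const"
  obtain B where B: "\<And>y. absval y \<le> R + absval b \<Longrightarrow> absval (entire_eval u y) \<le> B"
    using eval_bounded_on_disc[OF u] by blast
  obtain c :: 'a where c: "max B M < absval c" using ex_absval_large by blast
  obtain y where y: "entire_eval u y = c" by (rule entire_surjective[OF u nc])
  show False
  proof (cases "absval (y - b) > R")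
    case True
    from bound[OF this] show False using y c by simp
  next
    case False
    then have "absval y \<le> R + absval b" using absval_triangle[of "y - b" b] by simp
    from B[OF this] show False using y c by simp
  qed
qed

text \<open>
The statement describes a function \<open>W / (X - b)\<^sup>n\<close> that is bounded near infinity.  Splitting off the
polar part \<open>W b / (X - b)\<^sup>n\<close> lowers \<open>n\<close> and keeps the function bounded; the case \<open>n = 0\<close> is Liouville's
theorem.
\<close>

lemma polynomial_in_inverse_if_growth_bounded:
  assumes "(W :: 'a fps) \<in> entire_functions" "R \<ge> 1"
    and "\<And>y. absval (y - b) > R \<Longrightarrow> absval (entire_eval W y) \<le> M * absval (y - b) ^ n"
  shows "\<exists>q. \<forall>y. y \<noteq> b \<longrightarrow> entire_eval W y = (y - b) ^ n * poly q (1 / (y - b))"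
  using assms(1,3)
proof (induction n arbitrary: W M)
  case 0
  then obtain c where "W = fps_const c" using constant_if_bounded[of W R b M] by auto
  then show ?case by (intro exI[of _ "[:c:]"]) simp
next
  case (Suc n)
  define w where "w = entire_eval W b"
  obtain V where V: "V \<in> entire_functions" "W = fps_const w + (fps_X - fps_const b) * V"
    unfolding w_def by (rule entire_division[OF Suc.prems(1)])
  have eval: "entire_eval W y = w + (y - b) * entire_eval V y" for y
    using V by (simp add: entire_diff entire_mult)
  have "\<exists>q. \<forall>y. y \<noteq> b \<longrightarrow> entire_eval V y = (y - b) ^ n * poly q (1 / (y - b))"
  proof (rule Suc.IH[OF V(1)])
    fix y assume y: "absval (y - b) > R"
    then have t: "absval (y - b) > 1" using assms(2) by simp
    have "absval (y - b) * absval (entire_eval V y) = absval (entire_eval W y + (- w))"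
      by (simp add: eval flip: absval_mult)
    also have "\<dots> \<le> M * absval (y - b) ^ Suc n + absval w"
      using absval_triangle[of "entire_eval W y" "- w"] Suc.prems(2)[OF y] by simp
    also have "\<dots> \<le> M * absval (y - b) ^ Suc n + absval w * absval (y - b) ^ Suc n"
      using t mult_left_mono[OF one_le_power[of "absval (y - b)" "Suc n"], of "absval w"] by simp
    also have "\<dots> = absval (y - b) * ((M + absval w) * absval (y - b) ^ n)"
      by (simp add: algebra_simps)
    finally show "absval (entire_eval V y) \<le> (M + absval w) * absval (y - b) ^ n"
      using t by (subst (asm) mult_le_cancel_left_pos) auto
  qed
  then obtain q where q: "\<And>y. y \<noteq> b \<Longrightarrow> entire_eval V y = (y - b) ^ n * poly q (1 / (y - b))"
    by blast
  have "entire_eval W y = (y - b) ^ Suc n * poly (q + monom w (Suc n)) (1 / (y - b))" if "y \<noteq> b" for y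
    using that q[OF that] by (simp add: eval poly_monom field_simps)
  then show ?case by blast
qed

lemma entire_order:
  assumes "(v :: 'a fps) \<in> entire_functions" "v \<noteq> 0"
  obtains n k where "k \<in> entire_functions" "v = (fps_X - fps_const b) ^ n * k" "entire_eval k b \<noteq> 0"
proof -
  define r where "r = absval b + 1"
  have r: "r > 0" "absval b \<le> r" by (auto simp: r_def add_nonneg_pos)
  obtain d where "dominant_index r v d" using dominant_index_exists[OF assms r(1)] by blast
  then have "\<exists>n k. k \<in> entire_functions \<and> v = (fps_X - fps_const b) ^ n * k \<and> entire_eval k b \<noteq> 0"
    using assms(1)
  proof (induction d arbitrary: v)
    case 0
    then have "entire_eval v b \<noteq> 0" using eval_nonzero_if_dominant_index_0 r by blast
    then show ?case using 0 by (intro exI[of _ 0] exI[of _ v]) simp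
  next
    case (Suc d)
    show ?case
    proof (cases "entire_eval v b = 0")
      case True
      then obtain w where w: "w \<in> entire_functions" "v = (fps_X - fps_const b) * w"
        by (rule factor_at_zero[OF Suc.prems(2)])
      then have "dominant_index r w d"
        using dominant_index_factor[OF w(1) r] Suc.prems(1) by blast
      from Suc.IH[OF this w(1)] obtain n k where
        "k \<in> entire_functions" "w = (fps_X - fps_const b) ^ n * k" "entire_eval k b \<noteq> 0" by blast
      then show ?thesis using w(2) by (intro exI[of _ "Suc n"] exI[of _ k]) (simp add: mult.assoc)
    next
      case False
      then show ?thesis using Suc.prems(2) by (intro exI[of _ 0] exI[of _ v]) simp
    qed
  qed
  then show ?thesis using that by blast
qed

section \<open>Values and poles of meromorphic functions\<close>

lemma has_valueI:
  assumes "(u :: 'a fps) \<in> entire_functions" "v \<in> entire_functions" "entire_eval v x \<noteq> 0"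
  shows "has_value (Fract u v) x (entire_eval u x / entire_eval v x)"
  using assms unfolding has_value_def by blast

text \<open>
The two sides of \<open>u t = s v\<close>, evaluated at \<open>x\<close>, compare \<open>u / v\<close> with the representation \<open>s / t\<close> that
gives the value; \<open>v\<close> may vanish at \<open>x\<close>.
\<close>

lemma has_value_cross:
  assumes "has_value (Fract u v) x y" "(u :: 'a fps) \<in> entire_functions" "v \<in> entire_functions" "v \<noteq> 0"
  shows "entire_eval u x = y * entire_eval v x"
proof -
  obtain s t where st: "s \<in> entire_functions" "t \<in> entire_functions" "Fract u v = Fract s t"
    "entire_eval t x \<noteq> 0" "y = entire_eval s x / entire_eval t x"
    using assms(1) unfolding has_value_def by blast
  have "t \<noteq> 0" using st(4) by auto
  then have "u * t = s * v" using st(3) assms(4) by (simp add: eq_fract)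
  then have "entire_eval (u * t) x = entire_eval (s * v) x" by simp
  then have "entire_eval u x * entire_eval t x = entire_eval s x * entire_eval v x"
    using st assms by simp
  moreover have "entire_eval s x = y * entire_eval t x" using st(4,5) by simp
  ultimately have "entire_eval u x * entire_eval t x = (y * entire_eval v x) * entire_eval t x"
    by (simp only: mult_ac)
  then show ?thesis using st(4) by simp
qed

lemma has_value_unique:
  assumes "has_value (h :: 'a fps fract) x y" "has_value h x z"
  shows "y = z"
proof -
  obtain s t where st: "s \<in> entire_functions" "t \<in> entire_functions" "h = Fract s t"
    "entire_eval t x \<noteq> 0" "y = entire_eval s x / entire_eval t x"
    using assms(1) unfolding has_value_def by blast
  moreover have "t \<noteq> 0" using st(4) by auto
  ultimately show ?thesis using has_value_cross[of s t x z] assms(2) by simp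
qed

lemma has_value_entire:
  assumes "(u :: 'a fps) \<in> entire_functions"
  shows "has_value (Fract u 1) x y \<longleftrightarrow> y = entire_eval u x"
  using has_valueI[OF assms entire_1, of x] has_value_unique[of "Fract u 1" x] by auto

text \<open>
Common zeros are cancelled on a single disc only, where they are finite in number.  This takes the
place of a global coprime representation, which would need infinite products.
\<close>

lemma reduced_fraction:
  assumes "(h :: 'a fps fract) \<in> meromorphic_functions" "r > 0"
  obtains u v where "u \<in> entire_functions" "v \<in> entire_functions" "v \<noteq> 0" "h = Fract u v"
    "\<And>x. absval x \<le> r \<Longrightarrow> entire_eval v x = 0 \<Longrightarrow> entire_eval u x \<noteq> 0"
proof -
  obtain u v where uv: "u \<in> entire_functions" "v \<in> entire_functions" "v \<noteq> 0" "h = Fract u v"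
    using assms(1) by (auto simp: meromorphic_functions_def)
  obtain d where "dominant_index r v d" using dominant_index_exists[OF uv(2,3) assms(2)] by blast
  then have "\<exists>u v. u \<in> entire_functions \<and> v \<in> entire_functions \<and> v \<noteq> 0 \<and> h = Fract u v \<and>
      (\<forall>x. absval x \<le> r \<longrightarrow> entire_eval v x = 0 \<longrightarrow> entire_eval u x \<noteq> 0)"
    using uv
  proof (induction d arbitrary: u v)
    case 0
    then show ?case using eval_nonzero_if_dominant_index_0[OF _ assms(2)] by blast
  next
    case (Suc d)
    show ?case
    proof (cases "\<exists>x. absval x \<le> r \<and> entire_eval v x = 0 \<and> entire_eval u x = 0")
      case True
      then obtain a where a: "absval a \<le> r" "entire_eval v a = 0" "entire_eval u a = 0" by blast
      obtain s where s: "s \<in> entire_functions" "u = (fps_X - fps_const a) * s"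
        by (rule factor_at_zero[OF Suc.prems(2) a(3)])
      obtain t where t: "t \<in> entire_functions" "v = (fps_X - fps_const a) * t"
        by (rule factor_at_zero[OF Suc.prems(3) a(2)])
      have "dominant_index r t d"
        using dominant_index_factor[OF t(1) assms(2) a(1)] Suc.prems(1) t(2) by blast
      moreover have "t \<noteq> 0" "h = Fract s t"
        using Suc.prems(4,5) s(2) t(2) by (auto simp: eq_fract)
      ultimately show ?thesis using Suc.IH s(1) t(1) by blast
    next
      case False
      then show ?thesis using Suc.prems by blast
    qed
  qed
  then show ?thesis using that by blast
qed

text \<open>
A series with dominant index \<open>0\<close> is a unit on the disc; the estimate follows the recursion for the
coefficients of a quotient.
\<close>

lemma quotient_bounded_if_dominant_index_0:
  assumes v: "dominant_index r (v :: 'a fps) 0" and r: "r > 0"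
    and qv: "\<And>n. absval (fps_nth (q * v) n) * r ^ n \<le> B"
  shows "absval (fps_nth q n) * r ^ n \<le> B / absval (fps_nth v 0)"
proof (induction n rule: less_induct)
  case (less n)
  have v0: "absval (fps_nth v 0) > 0" using dominant_indexD(1)[OF v] by simp
  have B: "B \<ge> 0" using qv[of 0] order_trans[OF absval_nonneg, of "fps_nth (q * v) 0"] by simp
  have "fps_nth (q * v) n = (\<Sum>i\<in>{0..n}. fps_nth q i * fps_nth v (n - i))"
    by (rule fps_mult_nth)
  also have "\<dots> = fps_nth q n * fps_nth v 0 + (\<Sum>i\<in>{0..n} - {n}. fps_nth q i * fps_nth v (n - i))"
    by (subst sum.remove[of _ n]) auto
  finally have "fps_nth q n * fps_nth v 0 =
      fps_nth (q * v) n - (\<Sum>i\<in>{0..n} - {n}. fps_nth q i * fps_nth v (n - i))"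
    by simp
  also have "absval \<dots> \<le> B / r ^ n"
  proof (intro absval_diff_le absval_sum_bound)
    show "absval (fps_nth (q * v) n) \<le> B / r ^ n"
      using qv[of n] r by (simp add: pos_le_divide_eq)
    fix i assume i: "i \<in> {0..n} - {n}"
    have "absval (fps_nth q i * fps_nth v (n - i)) * r ^ n =
        (absval (fps_nth q i) * r ^ i) * (absval (fps_nth v (n - i)) * r ^ (n - i))"
      using i by (simp add: absval_mult flip: power_add)
    also have "\<dots> \<le> (B / absval (fps_nth v 0)) * absval (fps_nth v 0)"
      using less[of i] i dominant_indexD(2)[OF v, of "n - i"] r B v0 by (intro mult_mono) auto
    finally show "absval (fps_nth q i * fps_nth v (n - i)) \<le> B / r ^ n"
      using r v0 by (simp add: pos_le_divide_eq)
  qed (use B r in auto)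
  finally show ?case using r v0 by (simp add: absval_mult field_simps)
qed

lemma entire_if_no_pole:
  assumes h: "(h :: 'a fps fract) \<in> meromorphic_functions" and val: "\<And>x. \<exists>y. has_value h x y"
  obtains q where "q \<in> entire_functions" "h = Fract q 1"
proof -
  have reduced: "\<exists>u v. u \<in> entire_functions \<and> v \<in> entire_functions \<and> v \<noteq> 0 \<and> h = Fract u v \<and>
      dominant_index r v 0" if r: "r > 0" for r
  proof -
    obtain u v where uv: "u \<in> entire_functions" "v \<in> entire_functions" "v \<noteq> 0" "h = Fract u v"
      and red: "\<And>x. absval x \<le> r \<Longrightarrow> entire_eval v x = 0 \<Longrightarrow> entire_eval u x \<noteq> 0"
      using reduced_fraction[OF h r] by blast
    have "entire_eval v x \<noteq> 0" if "absval x \<le> r" for x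
      using red[OF that] val[of x] has_value_cross[OF _ uv(1,2,3), of x] uv(4) by auto
    moreover obtain d where d: "dominant_index r v d"
      using dominant_index_exists[OF uv(2,3) r] by blast
    ultimately have "d = 0" using zero_if_dominant_index_pos[OF uv(2) r d] by blast
    then show ?thesis using uv d by blast
  qed
  obtain u v where uv: "u \<in> entire_functions" "v \<in> entire_functions" "v \<noteq> 0" "h = Fract u v"
    "dominant_index 1 v 0" using reduced[of 1] by auto
  \<comment> \<open>On every disc \<open>h\<close> has a denominator without zeros there, and all these fractions define the same power series \<open>q\<close>.\<close>
  define q where "q = u * inverse v"
  have "fps_nth v 0 \<noteq> 0" using dominant_indexD(1)[OF uv(5)] .
  then have "q * v = u" by (simp add: q_def mult.assoc inverse_mult_eq_1)
  then have hq: "h = Fract q 1" using uv by (simp add: eq_fract)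
  have "q \<in> entire_functions"
    unfolding entire_iff_bounded
  proof (intro allI impI)
    fix r :: real assume r: "r > 0"
    obtain s t where st: "s \<in> entire_functions" "t \<in> entire_functions" "t \<noteq> 0" "h = Fract s t"
      "dominant_index r t 0" using reduced[OF r] by blast
    then have "q * t = s" using hq by (simp add: eq_fract)
    moreover obtain B where "\<And>n. absval (fps_nth s n) * r ^ n \<le> B"
      using entire_boundedE[OF st(1) r] by blast
    ultimately show "\<exists>B. \<forall>n. absval (fps_nth q n) * r ^ n \<le> B"
      using quotient_bounded_if_dominant_index_0[OF st(5) r, of q B] by blast
  qed
  with hq that show ?thesis by blast
qed

text \<open>
A local open mapping property at the pole: in reduced form \<open>g = u / v\<close> the denominator has a positive
dominant index, and so has its perturbation \<open>v - u / y\<close> for large \<open>y\<close>.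
\<close>

lemma large_values_near_pole:
  assumes g: "(g :: 'a fps fract) \<in> meromorphic_functions" and pole: "\<And>y. \<not> has_value g a y"
  obtains R r where "\<And>y. absval y > R \<Longrightarrow> \<exists>x. absval x \<le> r \<and> has_value g x y"
proof -
  define r where "r = absval a + 1"
  have r: "r > 0" "absval a \<le> r" by (auto simp: r_def add_nonneg_pos)
  obtain u v where uv: "u \<in> entire_functions" "v \<in> entire_functions" "v \<noteq> 0" "g = Fract u v"
    and red: "\<And>x. absval x \<le> r \<Longrightarrow> entire_eval v x = 0 \<Longrightarrow> entire_eval u x \<noteq> 0"
    using reduced_fraction[OF g r(1)] by blast
  have "entire_eval v a = 0" using pole has_valueI[OF uv(1,2), of a] uv(4) by blast
  moreover obtain d where d: "dominant_index r v d" using dominant_index_exists[OF uv(2,3) r(1)] by blast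
  ultimately have "d > 0"
    using eval_nonzero_if_dominant_index_0[OF uv(2) r(1) _ r(2)] by (cases d) auto
  define A where "A = absval (fps_nth v d) * r ^ d"
  have A: "A > 0" using dominant_indexD(1)[OF d] r by (simp add: A_def)
  obtain B where B: "B \<ge> 0" "\<And>n. absval (fps_nth u n) * r ^ n \<le> B"
    using entire_boundedE[OF uv(1) r(1)] by blast
  have "\<exists>x. absval x \<le> r \<and> has_value g x y" if y: "absval y > B / A" for y
  proof -
    have y0: "absval y > 0" using y A B by (meson divide_nonneg_pos order.strict_trans1)
    \<comment> \<open>In the disc the zeros of \<open>w\<close> are the solutions of \<open>g x = y\<close>; for large \<open>y\<close> the series \<open>w\<close> is a small perturbation of \<open>v\<close>.\<close>
    define w where "w = v - fps_const (1 / y) * u"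
    have w: "w \<in> entire_functions" using uv by (auto simp: w_def)
    have "dominant_index r w d"
    proof (rule dominant_index_perturb(1)[OF d r(1)])
      fix n
      have "absval (fps_nth w n - fps_nth v n) = absval (fps_nth u n) / absval y"
        by (simp add: w_def divide_inverse absval_mult absval_inverse)
      then have "absval (fps_nth w n - fps_nth v n) * r ^ n = absval (fps_nth u n) * r ^ n / absval y"
        by (simp only: times_divide_eq_left)
      also have "\<dots> \<le> B / absval y" using B(2) y0 by (intro divide_right_mono) auto
      finally show "absval (fps_nth w n - fps_nth v n) * r ^ n \<le> B / absval y" .
    next
      show "B / absval y < absval (fps_nth v d) * r ^ d"
        using y A y0 by (fold A_def) (simp add: pos_divide_less_eq mult.commute)
    qed
    then obtain x where x: "absval x \<le> r" "entire_eval w x = 0"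
      using zero_if_dominant_index_pos[OF w r(1) _ \<open>d > 0\<close>] by blast
    then have eq: "entire_eval v x = entire_eval u x / y"
      using uv by (simp add: w_def entire_mult)
    then have "entire_eval v x \<noteq> 0" using red[OF x(1)] y0 by auto
    then have "has_value g x (entire_eval u x / entire_eval v x)"
      using has_valueI[OF uv(1,2)] uv(4) by simp
    moreover have "entire_eval u x / entire_eval v x = y"
      using eq \<open>entire_eval v x \<noteq> 0\<close> y0 by auto
    ultimately show ?thesis using x(1) by auto
  qed
  then show ?thesis using that by blast
qed

section \<open>Decompositions into entire functions\<close>

text \<open>
If \<open>f' c = 0\<close>, then \<open>f - f c = (X - c)\<^sup>2 l\<close>.  Hence \<open>F - f c = (g - c)\<^sup>2 (l \<circ> g)\<close> holds pointwise and \<open>F - f c\<close>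
vanishes to second order at \<open>a\<close>.  As a multiple zero is a divisibility between power series, the
pointwise identity has to be transferred to the cofactors of \<open>X - a\<close>; this avoids constructing the
power series of \<open>l \<circ> g\<close>.
\<close>

lemma multiple_zero_of_composition:
  assumes F: "(F :: 'a fps) \<in> entire_functions" and f: "f \<in> entire_functions" and g: "g \<in> entire_functions"
    and comp: "\<And>x. entire_eval F x = entire_eval f (entire_eval g x)"
    and crit: "entire_eval (fps_deriv f) c = 0" and a: "entire_eval g a = c"
  shows "multiple_zero (F - fps_const (entire_eval f c)) a"
proof -
  define \<beta> where "\<beta> = entire_eval f c"
  obtain k where k: "k \<in> entire_functions" "f = fps_const \<beta> + (fps_X - fps_const c) * k"
    unfolding \<beta>_def by (rule entire_division[OF f])
  have "fps_deriv f = k + (fps_X - fps_const c) * fps_deriv k"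
    by (subst k(2)) (simp add: algebra_simps)
  then have "entire_eval k c = 0"
    using crit k(1) by (simp add: entire_diff entire_mult entire_deriv)
  then obtain l where l: "l \<in> entire_functions" "k = (fps_X - fps_const c) * l"
    by (rule factor_at_zero[OF k(1)])
  have f_val: "entire_eval f y = \<beta> + (y - c) ^ 2 * entire_eval l y" for y
    using k l by (simp add: entire_diff entire_mult power2_eq_square)
  obtain m where m: "m \<in> entire_functions" "g - fps_const c = (fps_X - fps_const a) * m"
    using factor_at_zero[OF entire_diff[OF g entire_const], of c a] a g by auto
  have "entire_eval (g - fps_const c) x = entire_eval ((fps_X - fps_const a) * m) x" for x
    by (simp only: m(2))
  then have g_val: "entire_eval g x - c = (x - a) * entire_eval m x" for x
    using g m(1) by (simp add: entire_diff)
  have F\<beta>: "F - fps_const \<beta> \<in> entire_functions" using F by auto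
  have "entire_eval (F - fps_const \<beta>) a = 0" using F comp a by (simp add: \<beta>_def)
  then obtain h where h: "h \<in> entire_functions" "F - fps_const \<beta> = (fps_X - fps_const a) * h"
    by (rule factor_at_zero[OF F\<beta>])
  have "entire_eval (F - fps_const \<beta>) x = entire_eval ((fps_X - fps_const a) * h) x" for x
    by (simp only: h(2))
  then have F_val: "entire_eval F x - \<beta> = (x - a) * entire_eval h x" for x
    using F h(1) by (simp add: entire_diff)
  have h_val: "entire_eval h x = (x - a) * (entire_eval m x ^ 2 * entire_eval l (entire_eval g x))"
    if "x \<noteq> a" for x
  proof -
    have "(x - a) * entire_eval h x = (entire_eval g x - c) ^ 2 * entire_eval l (entire_eval g x)"
      using F_val[of x] comp[of x] f_val[of "entire_eval g x"] by simp
    also have "\<dots> = (x - a) * ((x - a) * (entire_eval m x ^ 2 * entire_eval l (entire_eval g x)))"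
      by (simp add: g_val power2_eq_square)
    finally show ?thesis using that by simp
  qed
  \<comment> \<open>The factorization shows \<open>\<bar>h x\<bar> \<le> const \<cdot> \<bar>x - a\<bar>\<close> for \<open>x \<noteq> a\<close> near \<open>a\<close>; as \<open>h\<close> is Lipschitz, \<open>h a = 0\<close>.\<close>
  have "entire_eval h a = 0"
  proof (rule ccontr)
    assume ha: "entire_eval h a \<noteq> 0"
    define r where "r = absval a + 1"
    obtain Bm where Bm: "Bm \<ge> 0" "\<And>x. absval x \<le> r \<Longrightarrow> absval (entire_eval m x) \<le> Bm"
      using eval_bounded_on_disc[OF m(1)] by blast
    obtain Bg where Bg: "\<And>x. absval x \<le> r \<Longrightarrow> absval (entire_eval g x) \<le> Bg"
      using eval_bounded_on_disc[OF g] by blast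
    obtain Bl where Bl: "Bl \<ge> 0" "\<And>x. absval x \<le> Bg \<Longrightarrow> absval (entire_eval l x) \<le> Bl"
      using eval_bounded_on_disc[OF l(1)] by blast
    obtain n where n: "n \<in> entire_functions" "h = fps_const (entire_eval h a) + (fps_X - fps_const a) * n"
      by (rule entire_division[OF h(1)])
    obtain Bn where Bn: "Bn \<ge> 0" "\<And>x. absval x \<le> r \<Longrightarrow> absval (entire_eval n x) \<le> Bn"
      using eval_bounded_on_disc[OF n(1)] by blast
    define C where "C = Bm ^ 2 * Bl + Bn + 1"
    have C: "C > 0" using Bm Bl Bn by (simp add: C_def add_nonneg_pos)
    obtain t :: 'a where t: "t \<noteq> 0" "absval t < min 1 (absval (entire_eval h a) / C)"
      using ex_absval_small[of "min 1 (absval (entire_eval h a) / C)"] ha C by auto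
    define x where "x = a + t"
    have x: "absval x \<le> r" "x \<noteq> a" "x - a = t"
      using t absval_triangle[of a t] by (auto simp: x_def r_def)
    have "entire_eval h x = entire_eval h a + (x - a) * entire_eval n x"
      using n(1) by (subst n(2)) (simp add: entire_diff entire_mult)
    then have "entire_eval h a = t * (entire_eval m x ^ 2 * entire_eval l (entire_eval g x) - entire_eval n x)"
      using h_val[OF x(2)] x(3) by (simp add: algebra_simps)
    also have "absval \<dots> \<le> absval t * C"
    proof -
      have "absval (entire_eval m x ^ 2 * entire_eval l (entire_eval g x) - entire_eval n x) \<le>
          absval (entire_eval m x) ^ 2 * absval (entire_eval l (entire_eval g x)) + absval (entire_eval n x)"
        using absval_triangle[of _ "- entire_eval n x"] by (simp flip: absval_mult absval_power)
      also have "\<dots> \<le> Bm ^ 2 * Bl + Bn"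
        using Bm(2)[OF x(1)] Bl(2)[OF Bg[OF x(1)]] Bn(2)[OF x(1)] Bm(1) Bl(1)
        by (intro add_mono mult_mono power_mono) auto
      also have "\<dots> \<le> C" by (simp add: C_def)
      finally show ?thesis by (simp add: absval_mult mult_left_mono)
    qed
    also have "\<dots> < absval (entire_eval h a)" using t(2) C by (simp add: pos_less_divide_eq)
    finally show False by simp
  qed
  then obtain n where "n \<in> entire_functions" "h = (fps_X - fps_const a) * n"
    by (rule factor_at_zero[OF h(1)])
  then show ?thesis
    using h(2) unfolding multiple_zero_def \<beta>_def
    by (intro bexI[of _ n]) (simp_all add: power2_eq_square mult.assoc)
qed

text \<open>
A zero \<open>c\<close> of \<open>f'\<close> would make every solution of \<open>g x = c\<close> a multiple zero of \<open>F - f c\<close>, and there are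
infinitely many solutions.  So \<open>f'\<close> has no zero and is constant.
\<close>

lemma left_factor_linear:
  assumes F: "(F :: 'a fps) \<in> entire_functions" and f: "f \<in> entire_functions" and g: "g \<in> entire_functions"
    and comp: "\<And>x. entire_eval F x = entire_eval f (entire_eval g x)"
    and F_nonpoly: "F \<notin> range fps_of_poly" and g_nonpoly: "g \<notin> range fps_of_poly"
    and fin: "\<And>\<beta>. finite {a. multiple_zero (F - fps_const \<beta>) a}"
  obtains \<alpha> \<beta> where "\<beta> \<noteq> 0" "f = fps_of_poly [:\<alpha>, \<beta>:]"
proof -
  have "entire_eval (fps_deriv f) c \<noteq> 0" for c
  proof
    assume crit: "entire_eval (fps_deriv f) c = 0"
    have "{a. entire_eval g a = c} \<subseteq> {a. multiple_zero (F - fps_const (entire_eval f c)) a}"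
      using multiple_zero_of_composition[OF F f g comp crit] by blast
    then show False
      using infinitely_many_preimages[OF g g_nonpoly] fin finite_subset by blast
  qed
  then obtain \<beta> where \<beta>: "fps_deriv f = fps_const \<beta>"
    using constant_if_no_zero[OF entire_deriv[OF f]] by blast
  define \<alpha> where "\<alpha> = fps_nth f 0"
  have f_eq: "f = fps_of_poly [:\<alpha>, \<beta>:]"
  proof (rule fps_ext)
    fix n
    show "fps_nth f n = fps_nth (fps_of_poly [:\<alpha>, \<beta>:]) n"
    proof (cases n)
      case (Suc m)
      have "of_nat (Suc m) * fps_nth f (Suc m) = (if m = 0 then \<beta> else 0)"
        using arg_cong[OF \<beta>, of "\<lambda>u. fps_nth u m"] by (simp del: of_nat_Suc)
      then have "fps_nth f (Suc m) = (if m = 0 then \<beta> else 0)"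
        by (cases "m = 0") (auto simp del: of_nat_Suc)
      then show ?thesis using Suc by (cases m) auto
    qed (simp add: \<alpha>_def)
  qed
  have "\<beta> \<noteq> 0"
  proof
    assume "\<beta> = 0"
    then have "F = fps_const \<alpha>"
      using F comp f_eq by (intro entire_eqI) auto
    then show False using F_nonpoly fps_const_range_subset_poly by blast
  qed
  with f_eq that show ?thesis by blast
qed

lemma entire_compose_poly:
  assumes H: "(H :: 'a fps) \<in> entire_functions"
  obtains k where "k \<in> entire_functions" "\<And>x. entire_eval k x = poly q (entire_eval H x)"
proof -
  have "\<exists>k\<in>entire_functions. \<forall>x. entire_eval k x = poly q (entire_eval H x)"
  proof (induction q)
    case 0
    show ?case by (intro bexI[of _ 0]) auto
  next
    case (pCons c q)
    then obtain k where k: "k \<in> entire_functions" "\<And>x. entire_eval k x = poly q (entire_eval H x)"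
      by blast
    show ?case by (intro bexI[of _ "fps_const c + H * k"]) (use H k in \<open>auto simp: entire_mult\<close>)
  qed
  then show ?thesis using that by blast
qed

section \<open>Decompositions into meromorphic functions\<close>

text \<open>
The function \<open>H = 1 / (g - b)\<close> has no poles because \<open>g\<close> omits \<open>b\<close>; at the poles of \<open>g\<close> it vanishes.
\<close>

lemma inverse_shift_entire:
  assumes g: "(g :: 'a fps fract) \<in> meromorphic_functions" and nonconst: "g \<noteq> Fract (fps_const b) 1"
    and omits: "\<And>x. \<not> has_value g x b"
  obtains H where "H \<in> entire_functions" "H \<noteq> 0" "g = Fract (1 + fps_const b * H) H"
proof -
  obtain u v where uv: "u \<in> entire_functions" "v \<in> entire_functions" "v \<noteq> 0" "g = Fract u v"
    using g by (auto simp: meromorphic_functions_def)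
  have diff_nonzero: "s - fps_const b * t \<noteq> 0" if "t \<noteq> 0" "g = Fract s t" for s t
    using that nonconst by (auto simp: eq_fract)
  define h where "h = Fract v (u - fps_const b * v)"
  have "h \<in> meromorphic_functions"
    using uv diff_nonzero[OF uv(3,4)] unfolding h_def meromorphic_functions_def
    by (intro CollectI exI[of _ v] exI[of _ "u - fps_const b * v"]) auto
  moreover have "\<exists>y. has_value h x y" for x
  proof -
    obtain s t where st: "s \<in> entire_functions" "t \<in> entire_functions" "t \<noteq> 0" "g = Fract s t"
      and red: "\<And>z. absval z \<le> absval x + 1 \<Longrightarrow> entire_eval t z = 0 \<Longrightarrow> entire_eval s z \<noteq> 0"
      using reduced_fraction[OF g, of "absval x + 1"] by (metis absval_nonneg add_nonneg_pos zero_less_one)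
    have "h = Fract t (s - fps_const b * t)"
    proof -
      have "u * t = s * v" using uv st by (simp add: eq_fract)
      then show ?thesis unfolding h_def
        using diff_nonzero[OF uv(3,4)] diff_nonzero[OF st(3,4)]
        by (simp add: eq_fract algebra_simps)
    qed
    moreover have "entire_eval (s - fps_const b * t) x \<noteq> 0"
    proof
      assume "entire_eval (s - fps_const b * t) x = 0"
      then have eq: "entire_eval s x = b * entire_eval t x" using st by (simp add: entire_mult)
      then have "entire_eval t x \<noteq> 0" using red[of x] by auto
      with eq has_valueI[OF st(1,2), of x] have "has_value g x b" using st(4) by simp
      with omits show False by blast
    qed
    ultimately show ?thesis using has_valueI[OF st(2) entire_diff[OF st(1) entire_mult[OF entire_const st(2)]]]
      by blast
  qed
  ultimately obtain H where H: "H \<in> entire_functions" "h = Fract H 1"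
    by (rule entire_if_no_pole)
  then have v_eq: "v = H * (u - fps_const b * v)"
    using diff_nonzero[OF uv(3,4)] by (simp add: h_def eq_fract)
  then have "H \<noteq> 0" using uv(3) by auto
  moreover have "u * H = (1 + fps_const b * H) * v"
    using v_eq by (simp add: algebra_simps)
  then have "g = Fract (1 + fps_const b * H) H"
    using uv(3,4) \<open>H \<noteq> 0\<close> by (simp add: eq_fract)
  ultimately show ?thesis using that H(1) by blast
qed

text \<open>
Only the factor \<open>X - b\<close> of the denominator is responsible for poles of \<open>f\<close>; once it is cleared, the
remaining function has a value everywhere and is entire.
\<close>

lemma pole_clearing:
  assumes f: "(f :: 'a fps fract) \<in> meromorphic_functions" and val: "\<And>y. y \<noteq> b \<Longrightarrow> \<exists>z. has_value f y z"
  obtains W n where "W \<in> entire_functions" "f = Fract W ((fps_X - fps_const b) ^ n)"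
proof -
  obtain u v where uv: "u \<in> entire_functions" "v \<in> entire_functions" "v \<noteq> 0" "f = Fract u v"
    using f by (auto simp: meromorphic_functions_def)
  obtain n w where w: "w \<in> entire_functions" "v = (fps_X - fps_const b) ^ n * w" "entire_eval w b \<noteq> 0"
    by (rule entire_order[OF uv(2,3)])
  let ?P = "(fps_X - fps_const b) ^ n"
  have P: "?P \<in> entire_functions" "?P \<noteq> 0" "w \<noteq> 0" using w uv(3) by auto
  have "Fract u w \<in> meromorphic_functions"
    using uv w P by (auto simp: meromorphic_functions_def)
  moreover have "\<exists>z. has_value (Fract u w) y z" for y
  proof (cases "y = b")
    case True
    then show ?thesis using has_valueI[OF uv(1) w(1)] w(3) by blast
  next
    case False
    then obtain s t where st: "s \<in> entire_functions" "t \<in> entire_functions" "f = Fract s t" "entire_eval t y \<noteq> 0"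
      using val[OF False] unfolding has_value_def by blast
    then have "t \<noteq> 0" by auto
    then have "u * t = s * v" using uv st by (simp add: eq_fract)
    then have "Fract u w = Fract (s * ?P) t"
      using \<open>t \<noteq> 0\<close> P(3) w(2) by (simp add: eq_fract mult.assoc)
    then show ?thesis using has_valueI[OF entire_mult[OF st(1) P(1)] st(2,4)] by metis
  qed
  ultimately obtain W where W: "W \<in> entire_functions" "Fract u w = Fract W 1"
    by (rule entire_if_no_pole)
  then have "u = W * w" using P(3) by (simp add: eq_fract)
  then have "f = Fract W ?P" using uv w P by (simp add: eq_fract mult_ac)
  with W(1) that show ?thesis by blast
qed

text \<open>
All properties of \<open>\<complex>\<^sub>p\<close> that are used are collected in the locale: the field is complete, nontrivially
valued, nonarchimedean and algebraically closed.
\<close>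

theorem left_factor_linear_rational:
  assumes F: "(F :: 'a fps) \<in> entire_functions" and F_nonpoly: "F \<notin> range fps_of_poly"
    and fin: "\<And>\<beta>. finite {a. multiple_zero (F - fps_const \<beta>) a}"
    and f: "f \<in> meromorphic_functions" and g: "g \<in> meromorphic_functions"
    and comp: "is_composition (Fract F 1) f g" and g_nonrational: "g \<notin> rational_functions"
  shows "linear_rational f"
proof -
  have f_at_g: "has_value f y (entire_eval F x)" if "has_value g x y" for x y
    using comp that has_value_entire[OF F] unfolding is_composition_def by blast
  show ?thesis
  proof (cases "\<forall>x. \<exists>y. has_value g x y")
    case True
    then obtain G where G: "G \<in> entire_functions" "g = Fract G 1"
      using entire_if_no_pole[OF g] by blast
    have G_nonpoly: "G \<notin> range fps_of_poly"
    proof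
      assume "G \<in> range fps_of_poly"
      then obtain P where "g = Fract (fps_of_poly P) (fps_of_poly 1)" using G(2) by auto
      then show False using g_nonrational unfolding rational_functions_def
        using one_neq_zero by blast
    qed
    have value_G: "has_value f (entire_eval G x) (entire_eval F x)" for x
      using f_at_g has_value_entire[OF G(1)] G(2) by blast
    have "\<exists>z. has_value f y z" for y
    proof -
      have "G \<notin> range fps_const" using G_nonpoly fps_const_range_subset_poly by auto
      then obtain x where "entire_eval G x = y" by (rule entire_surjective[OF G(1)])
      with value_G[of x] show ?thesis by auto
    qed
    then obtain E where E: "E \<in> entire_functions" "f = Fract E 1"
      by (rule entire_if_no_pole[OF f])
    have "entire_eval F x = entire_eval E (entire_eval G x)" for x
      using value_G[of x] E has_value_entire[OF E(1)] by simp
    then obtain \<alpha> \<beta> where lin: "\<beta> \<noteq> 0" "E = fps_of_poly [:\<alpha>, \<beta>:]"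
      by (rule left_factor_linear[OF F E(1) G(1) _ F_nonpoly G_nonpoly fin])
    have "f = Fract (fps_of_poly [:\<alpha>, \<beta>:]) (fps_of_poly [:1, 0:])" using E(2) lin(2) by simp
    moreover have "\<beta> * 1 - \<alpha> * 0 \<noteq> 0" using lin(1) by simp
    ultimately show ?thesis unfolding linear_rational_def by blast
  next
    case False
    then obtain a where pole: "\<And>y. \<not> has_value g a y" by blast
    obtain R r where large: "\<And>y. absval y > R \<Longrightarrow> \<exists>x. absval x \<le> r \<and> has_value g x y"
      using large_values_near_pole[OF g pole] by blast
    obtain M where M: "\<And>x. absval x \<le> r \<Longrightarrow> absval (entire_eval F x) \<le> M"
      using eval_bounded_on_disc[OF F] by blast
    have f_bounded: "absval z \<le> M" if "absval y > R" "has_value f y z" for y z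
      using large[OF that(1)] f_at_g M has_value_unique[OF that(2)] by blast
    \<comment> \<open>Without a pole, \<open>f\<close> would be a bounded entire function, hence constant, and so would be \<open>F\<close>.\<close>
    have "\<exists>b. \<forall>z. \<not> has_value f b z"
    proof (rule ccontr)
      assume "\<not> ?thesis"
      then have "\<exists>z. has_value f b z" for b by blast
      then obtain E where E: "E \<in> entire_functions" "f = Fract E 1"
        by (rule entire_if_no_pole[OF f])
      have "absval (entire_eval E y) \<le> M" if "absval (y - 0) > R" for y
        using f_bounded[of y] that has_value_entire[OF E(1)] E(2) by simp
      then have "E \<in> range fps_const" by (rule constant_if_bounded[OF E(1)])
      then obtain c where c: "E = fps_const c" by blast
      obtain u v where uv: "u \<in> entire_functions" "v \<in> entire_functions" "v \<noteq> 0" "g = Fract u v"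
        using g by (auto simp: meromorphic_functions_def)
      \<comment> \<open>Multiplying by the denominator \<open>v\<close> of \<open>g\<close> removes the points where \<open>g\<close> may have a pole.\<close>
      have "entire_eval ((F - fps_const c) * v) x = entire_eval 0 x" for x
      proof (cases "entire_eval v x = 0")
        case False
        from f_at_g[OF has_valueI[OF uv(1,2) False, folded uv(4)]]
        have "entire_eval F x = c" using E c has_value_entire[OF E(1)] by simp
        then show ?thesis using F uv(2) by (simp add: entire_diff)
      qed (use F uv(2) in \<open>simp add: entire_diff\<close>)
      then have "(F - fps_const c) * v = 0"
        using F uv(2) by (intro entire_eqI) auto
      then have "F = fps_const c" using uv(3) by simp
      then show False using F_nonpoly fps_const_range_subset_poly by blast
    qed
    then obtain b where b: "\<And>z. \<not> has_value f b z" by blast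
    have "g \<noteq> Fract (fps_const b) 1"
    proof
      assume "g = Fract (fps_const b) 1"
      then have "g = Fract (fps_of_poly [:b:]) (fps_of_poly 1)" by (simp add: fps_of_poly_const)
      then show False using g_nonrational unfolding rational_functions_def
        using one_neq_zero by blast
    qed
    \<comment> \<open>\<open>F\<close> has no poles, so \<open>g\<close> never takes the value \<open>b\<close>; hence \<open>g = b + 1 / H\<close> with \<open>H\<close> entire.\<close>
    then obtain H where H: "H \<in> entire_functions" "H \<noteq> 0" "g = Fract (1 + fps_const b * H) H"
      using inverse_shift_entire[OF g, of b] f_at_g b by blast
    have H_nonpoly: "H \<notin> range fps_of_poly"
    proof
      assume "H \<in> range fps_of_poly"
      then obtain P where P: "H = fps_of_poly P" by blast
      then have "g = Fract (fps_of_poly (1 + [:b:] * P)) (fps_of_poly P)"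
        by (simp only: H(3) fps_of_poly_add fps_of_poly_mult fps_of_poly_const fps_of_poly_1)
      moreover have "P \<noteq> 0" using P H(2) by auto
      ultimately show False using g_nonrational unfolding rational_functions_def by blast
    qed
    have value_H: "has_value f (b + 1 / entire_eval H x) (entire_eval F x)" if "entire_eval H x \<noteq> 0" for x
    proof (rule f_at_g)
      have "entire_eval (1 + fps_const b * H) x / entire_eval H x = b + 1 / entire_eval H x"
        using H(1) that by (simp add: entire_mult field_simps)
      then show "has_value g x (b + 1 / entire_eval H x)"
        using has_valueI[OF entire_add[OF entire_1 entire_mult[OF entire_const H(1)]] H(1) that, of b] H(3)
        by metis
    qed
    have "\<exists>z. has_value f y z" if "y \<noteq> b" for y
    proof -
      have "H \<notin> range fps_const" using H_nonpoly fps_const_range_subset_poly by auto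
      then obtain x where x: "entire_eval H x = 1 / (y - b)" by (rule entire_surjective[OF H(1)])
      then show ?thesis using value_H[of x] that by auto
    qed
    then obtain W n where W: "W \<in> entire_functions" "f = Fract W ((fps_X - fps_const b) ^ n)"
      by (rule pole_clearing[OF f])
    have P: "(fps_X - fps_const b) ^ n \<in> entire_functions" by (intro entire_power entire_diff) auto
    have f_val: "has_value f y (entire_eval W y / (y - b) ^ n)" if "y \<noteq> b \<or> n = 0" for y
      using has_valueI[OF W(1) P, of y] that W(2) by (auto simp: entire_diff)
    then have "n \<noteq> 0" using b by blast
    \<comment> \<open>Near infinity the bound on \<open>f\<close> says that \<open>W\<close> grows at most like \<open>(y - b)\<^sup>n\<close>.\<close>
    have "absval (entire_eval W y) \<le> M * absval (y - b) ^ n" if "absval (y - b) > max 1 (R + absval b)" for y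
    proof -
      have "absval (y - b) \<le> absval y + absval b" using absval_triangle[of y "- b"] by simp
      then have "absval y > R" using that by simp
      moreover have pos: "absval (y - b) > 0" using that by linarith
      moreover have "y \<noteq> b" using pos by auto
      ultimately have le: "absval (entire_eval W y / (y - b) ^ n) \<le> M" using f_bounded f_val by blast
      have "entire_eval W y = entire_eval W y / (y - b) ^ n * (y - b) ^ n" using \<open>y \<noteq> b\<close> by simp
      then have "absval (entire_eval W y) = absval (entire_eval W y / (y - b) ^ n) * absval (y - b) ^ n"
        by (metis absval_mult absval_power)
      also have "\<dots> \<le> M * absval (y - b) ^ n" by (intro mult_right_mono le) simp
      finally show ?thesis .
    qed
    then obtain q where q: "\<And>y. y \<noteq> b \<Longrightarrow> entire_eval W y = (y - b) ^ n * poly q (1 / (y - b))"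
      using polynomial_in_inverse_if_growth_bounded[OF W(1), of "max 1 (R + absval b)" b M n] by auto
    have F_q: "entire_eval F x = poly q (entire_eval H x)" if "entire_eval H x \<noteq> 0" for x
    proof -
      let ?y = "b + 1 / entire_eval H x"
      have "?y \<noteq> b" using that by simp
      then have "entire_eval F x = entire_eval W ?y / (?y - b) ^ n"
        using value_H[OF that] f_val has_value_unique by blast
      also have "\<dots> = poly q (1 / (?y - b))" using q[OF \<open>?y \<noteq> b\<close>] \<open>?y \<noteq> b\<close> by simp
      finally show ?thesis by simp
    qed
    obtain k where k: "k \<in> entire_functions" "\<And>x. entire_eval k x = poly q (entire_eval H x)"
      using entire_compose_poly[OF H(1)] by blast
    \<comment> \<open>The identity \<open>F = q \<circ> H\<close> is known off the zeros of \<open>H\<close>; the factor \<open>H\<close> extends it to all points.\<close>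
    have "entire_eval ((F - k) * H) x = entire_eval 0 x" for x
      using F_q[of x] F k H(1) by (cases "entire_eval H x = 0") (simp_all add: entire_diff)
    then have "(F - k) * H = 0" using F k H(1) by (intro entire_eqI) auto
    then have "F = k" using H(2) by simp
    then have "entire_eval F x = entire_eval (fps_of_poly q) (entire_eval H x)" for x using k(2) by simp
    then obtain \<alpha> \<beta> where "\<beta> \<noteq> 0" "fps_of_poly q = fps_of_poly [:\<alpha>, \<beta>:]"
      by (rule left_factor_linear[OF F entire_of_poly H(1) _ F_nonpoly H_nonpoly fin])
    then have \<beta>: "\<beta> \<noteq> 0" and q_eq: "q = [:\<alpha>, \<beta>:]" by (simp_all add: fps_of_poly_eq_iff)
    \<comment> \<open>From \<open>W = (X - b)\<^sup>n q(1 / (X - b))\<close> and \<open>q = \<alpha> + \<beta> X\<close> one gets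
      \<open>f = \<alpha> + \<beta> / (X - b)\<close>.  At \<open>y = b\<close> the verification uses \<open>n > 0\<close>.\<close>
    have "W * fps_of_poly [:- b, 1:] = fps_of_poly [:\<beta> - \<alpha> * b, \<alpha>:] * (fps_X - fps_const b) ^ n"
    proof (rule entire_eqI)
      fix y
      show "entire_eval (W * fps_of_poly [:- b, 1:]) y =
          entire_eval (fps_of_poly [:\<beta> - \<alpha> * b, \<alpha>:] * (fps_X - fps_const b) ^ n) y"
      proof (cases "y = b")
        case True
        then show ?thesis using W(1) P \<open>n \<noteq> 0\<close> by (simp add: entire_diff)
      next
        case False
        have "entire_eval W y * (y - b) = (\<beta> - \<alpha> * b + y * \<alpha>) * (y - b) ^ n"
          using False by (simp add: q[OF False] q_eq field_simps)
        then show ?thesis using W(1) P by (simp add: entire_diff)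
      qed
    qed (use W(1) P in auto)
    moreover have "fps_of_poly [:- b, 1:] \<noteq> 0" "fps_of_poly [:- b, 1:] = fps_X - fps_const b"
      by (simp_all add: fps_of_poly_linear fps_of_poly_eq_iff[of _ 0, simplified] del: fps_of_poly_pCons)
    then have "fps_of_poly [:- b, 1:] \<noteq> 0" "(fps_X - fps_const b) ^ n \<noteq> 0" by simp_all
    ultimately have "f = Fract (fps_of_poly [:\<beta> - \<alpha> * b, \<alpha>:]) (fps_of_poly [:- b, 1:])"
      unfolding W(2) using eq_fract(1) by blast
    moreover have "\<alpha> * (- b) - (\<beta> - \<alpha> * b) * 1 \<noteq> 0" using \<beta> by simp
    ultimately show ?thesis unfolding linear_rational_def by blast
  qed
qed

end

section \<open>The field of complex p-adic numbers\<close>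

text \<open>
The approximants in \<open>poly_root_if_dense_coefficients\<close> have the coefficient \<open>0\<close> above their degree.
\<close>

lemma zero_mem_Qp_bar: "0 \<in> (Qp_bar :: 'a :: valued_field_char_0 set)"
proof -
  have "coeff [:0, 1 :: 'a:] i \<in> Qp" for i
    unfolding Qp_def using closure_subset[of "\<rat> :: 'a set"]
    by (cases i) (auto simp: coeff_pCons split: nat.split)
  then show ?thesis unfolding Qp_bar_def by (intro CollectI exI[of _ "[:0, 1:]"]) auto
qed

text \<open>
The integers have absolute value at most \<open>1\<close>, which gives the strong triangle inequality, and
\<open>\<bar>p\<bar> = 1 / p\<close>, which makes the absolute value nontrivial.
\<close>

lemma algebraically_closed_nonarchimedean_if_Cp:
  assumes "is_Cp p TYPE('a :: valued_field_char_0)"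
  shows "algebraically_closed_nonarchimedean TYPE('a)"
proof -
  have p: "prime p" using assms by (simp add: is_Cp_def)
  have val: "absval (of_int n :: 'a) = 1 / real p ^ multiplicity (int p) n" if "n \<noteq> 0" for n
    using assms that by (simp add: is_Cp_def)
  have p1: "real p > 1" using prime_gt_1_nat[OF p] by simp
  have nat_le: "absval (of_nat n :: 'a) \<le> 1" for n
  proof (cases "n = 0")
    case False
    then show ?thesis using val[of "int n"] p1 by simp
  qed simp
  interpret nonarchimedean "TYPE('a)"
  proof
    show "absval (x + y) \<le> max (absval x) (absval y)" for x y :: 'a
      by (rule ultrametric_if_naturals_bounded[OF nat_le])
    show "complete (UNIV :: 'a set)" using assms by (simp add: is_Cp_def)
    have "multiplicity (int p) (int p) = 1"
      using p by (intro multiplicity_self) auto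
    then have "absval (of_nat p :: 'a) = 1 / real p" using val[of "int p"] p1 by simp
    then show "\<exists>x::'a. x \<noteq> 0 \<and> absval x < 1" using p1 by (intro exI[of _ "of_nat p"]) auto
  qed
  show ?thesis
  proof
    have "closure (Qp_bar :: 'a set) = UNIV" using assms by (simp add: is_Cp_def)
    moreover have "\<exists>x. poly q x = 0" if "0 < degree q" "\<forall>i. coeff q i \<in> Qp_bar" for q :: "'a poly"
      using assms that unfolding is_Cp_def by blast
    ultimately show "\<exists>x. poly q x = 0" if "0 < degree q" for q :: "'a poly"
      using poly_root_if_dense_coefficients[OF _ zero_mem_Qp_bar] that by blast
  qed
qed

theorem theorem2p5:
  fixes p :: nat and F :: "'a :: valued_field_char_0 fps"
  assumes "prime p"
    and "is_Cp p TYPE('a)"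
    and "F \<in> entire_functions"
    and "F \<notin> range fps_of_poly"
    and "\<And>\<beta>. finite {a. multiple_zero (F - fps_const \<beta>) a}"
  shows "left_prime (Fract F 1)"
proof -
  interpret algebraically_closed_nonarchimedean "TYPE('a)"
    by (rule algebraically_closed_nonarchimedean_if_Cp[OF assms(2)])
  have "Fract F 1 \<in> meromorphic_functions"
    unfolding meromorphic_functions_def using assms(3) entire_1 one_neq_zero by blast
  then show ?thesis
    unfolding left_prime_def using left_factor_linear_rational[OF assms(3-5)] by blast
qed

end
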